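(* Let $\mathcal V\subset\mathfrak{sl}(N,\mathbb C)$ be a hypersurface orbital variety with $\sigma(\mathcal V)=\Pi$ and thickness $I=\mathrm{thick}(\sigma(\mathcal V))$. Let $\mathcal V_R$ be the Richardson orbital variety with $\tau(\mathcal V_R)=\tau(\mathcal V)$, and let $\lambda$ be the shape of its tableau $T_R$. If $I=1$, then the non-linear generator $f$ of the ideal of $\overline{\mathcal V}$ is (up to a nonzero scalar) $$f=m_{\lambda_1-1},$$ where $m_j$ denotes the coefficient of $t^{N-I-j}$ in $\det(\mathrm{cMin}_I(x_R+t\,\mathrm{id}))$.
   Context: Let $\mathfrak n$ be the strictly upper-triangular $N\times N$ complex matrices, with simple roots $\Pi=\{\alpha_1,\dots,\alpha_{N-1}\}$ and positive roots $R^+=\{\alpha(i,j)=\alpha_i+\cdots+\alpha_j : 1\le i\le j\le N-1\}$. The root vector $X_{\alpha(i,j)}$ spans the matrix position $(i,j+1)$, and $x_{i,j+1}$ is the corresponding coordinate. Identify $S(\mathfrak n)$ with $\mathbb C[x_{ij}: 1\le i<j\le N]$. For $\omega\subseteq\Pi$, $R^+(\omega)$ is the set of positive roots that are sums of elements of $\omega$. Orbital varieties: for a partition $\lambda$ of $N$, $\mathcal O_\lambda$ is the set of nilpotent matrices with Jordan blocks of sizes $\lambda_1,\lambda_2,\dots$. An orbital variety is an irreducible component of $\mathcal O_\lambda\cap\mathfrak n$ for some $\lambda$. Orbital varieties contained in $\mathcal O_\lambda$ are in bijection with standard Young tableaux of shape $\lambda$ (via the Robinson-Schensted correspondence). The tableau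 $T$ associated to $\mathcal V$ is the one in which, for each $k$, the boxes with entries $\le k$ form the Young diagram of the Jordan type of the upper-left $k\times k$ submatrix of a generic $x\in\mathcal V$. $\tau$-invariant: $\tau(\mathcal V)\subseteq\Pi$ is the set of simple roots $\alpha$ such that the subgroup generated by the root subgroups of $\pm\alpha$ stabilizes $\mathcal V$ under conjugation. Equivalently, $\alpha_i\in\tau(\mathcal V)$ iff $i$ lies in a strictly higher row than $i+1$ in $T$. For $\tau\subseteq\Pi$ let $\mathfrak m_\tau=\bigoplus_{\alpha\in R^+\setminus R^+(\tau)}\mathbb C X_\alpha$. The Richardson orbital variety with $\tau$-invariant $\tau$ is the unique orbital variety $\mathcal V_R$ with $\tau(\mathcal V_R)=\tau$ and $\overline{\mathcal V}_R=\mathfrak m_\tau$. A hypersurface orbital variety is an orbital variety $\mathcal V$ whose closure is a hypersurface (codimension one) in $\mathfrak m_{\tau(\mathcal V)}$. Non-linear generator: with $\tau=\tau(\mathcal V)$, the ideal of $\overline{\mathcal V}$ is generated by the coordinates $x_{st}$ with $\alpha(s,t-1)\in R^+(\tau)$ together with one irreducible homogeneous polynomial $f$ of degree $\ge2$ in the remaining coordinates, unique up to a nonzero scalar. $\sigma$-set: $\sigma(\mathcal V)$ is the smallest connected subset $\sigma$ of $\Pi$ (i.e. of the form $\{\alpha_a,\alpha_{a+1},\dots,\alpha_b\}$) such that $f\in S(\mathfrak n_\sigma)$, where $\mathfrak n_\sigma$ is the subalgebra of $\mathfrak n$ generated by the $X_\alpha$, $\alpha\in\sigma$. Chains of $T_R$: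 the orbits on $\{1,\dots,N\}$ of the group generated by the transpositions $(i\ i+1)$, $\alpha_i\in\tau$. They are intervals, numbered $C_1,\dots,C_{\lambda_1}$ in increasing order. The number of chains of length (cardinality) $i$ equals the number of columns of length $i$ in $T_R$. The tableau $T$ of $\mathcal V$ is obtained from $T_R$ by moving down one row the box of the largest element of some chain $C_t$ (other entries keep their rows), and $\mathrm{thick}(\sigma(\mathcal V)):=|C_t|$. When $\sigma(\mathcal V)=\Pi$, this moved box is $N$, $I=|C_1|=|C_{\lambda_1}|$, and $C_1,C_{\lambda_1}$ are the only chains of length $I$. Generic matrix and minors: $x_R$ is the generic matrix of $\mathfrak m_\tau$, i.e. the strictly upper-triangular matrix with $(k,l)$ entry the independent variable $x_{kl}$ if $\alpha(k,l-1)\notin R^+(\tau)$ and $0$ otherwise. For an $N\times N$ matrix $y$, $\mathrm{cMin}_k(y)$ is the $(N-k)\times(N-k)$ submatrix in the top right corner of $y$ (rows $1,\dots,N-k$, columns $k+1,\dots,N$). Thus $\det(\mathrm{cMin}_I(x_R+t\,\mathrm{id}))=m_{N-I}+m_{N-I-1}t+\cdots+m_I t^{N-2I}$. *)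

theory Defs
  imports
    "HOL-Library.Poly_Mapping"
    "HOL-Library.Multiset"
    "HOL-Library.Extended_Nat"
    "HOL-Computational_Algebra.Factorial_Ring"
    "HOL-Analysis.Abstract_Topology"
    "HOL-Algebra.Generated_Groups"
    "HOL-Algebra.Group_Action"
    "HOL-Algebra.Sym_Groups"
    "HOL-Algebra.Ideal"
    "Jordan_Normal_Form.Jordan_Normal_Form"
begin

text \<open>
  Conventions. The simple root \<open>\<alpha>\<^sub>i\<close> is represented by its index \<open>i\<close>, so \<open>\<Pi> = {1..<N}\<close>, and
  a set of simple roots is a set of indices. Indices of roots, coordinates and tableau entries
  start at 1, while the matrix library counts rows and columns from 0: the coordinate
  \<open>x\<^sub>i\<^sub>j\<close> of a matrix \<open>A\<close> is \<open>A $$ (i - 1, j - 1)\<close>.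
\<close>

section \<open>Roots and matrices\<close>

text \<open>A sum of simple roots is encoded as the multiset of its summands; it is a sum of elements of
  \<open>\<omega>\<close> iff all its summands lie in \<open>\<omega>\<close>, because simple roots are linearly independent.\<close>

definition pos_root :: "nat \<Rightarrow> nat \<Rightarrow> nat multiset" where
  "pos_root i j = mset_set {i..j}"

definition pos_roots :: "nat \<Rightarrow> nat multiset set" where
  "pos_roots N = {pos_root i j | i j. 1 \<le> i \<and> i \<le> j \<and> j \<le> N - 1}"

definition pos_roots_of :: "nat \<Rightarrow> nat set \<Rightarrow> nat multiset set" where
  "pos_roots_of N \<omega> = {\<beta> \<in> pos_roots N. set_mset \<beta> \<subseteq> \<omega>}"

definition strict_upper :: "nat \<Rightarrow> complex mat set" where
  "strict_upper N = {A \<in> carrier_mat N N. \<forall>i<N. \<forall>j<N. j \<le> i \<longrightarrow> A $$ (i, j) = 0}"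

text \<open>The matrix unit at the 1-based position \<open>(i, j)\<close>; \<open>X\<^bsub>\<alpha>(i,j)\<^esub> = munit N i (j + 1)\<close>.\<close>

definition munit :: "nat \<Rightarrow> nat \<Rightarrow> nat \<Rightarrow> complex mat" where
  "munit N i j = mat N N (\<lambda>(r, s). if r + 1 = i \<and> s + 1 = j then 1 else 0)"

definition richardson_space :: "nat \<Rightarrow> nat set \<Rightarrow> complex mat set" where
  "richardson_space N \<tau> = {A \<in> strict_upper N. \<forall>s t. 1 \<le> s \<and> s < t \<and> t \<le> N \<and>
     pos_root s (t - 1) \<in> pos_roots_of N \<tau> \<longrightarrow> A $$ (s - 1, t - 1) = 0}"


section \<open>Polynomials\<close>

type_synonym cpoly = "((nat \<times> nat) \<Rightarrow>\<^sub>0 nat) \<Rightarrow>\<^sub>0 complex"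

definition pvar :: "nat \<Rightarrow> nat \<Rightarrow> cpoly" where
  "pvar i j = Poly_Mapping.single (Poly_Mapping.single (i, j) 1) 1"

definition pconst :: "complex \<Rightarrow> cpoly" where
  "pconst c = Poly_Mapping.single 0 c"

definition polys_in :: "(nat \<times> nat) set \<Rightarrow> cpoly set" where
  "polys_in W = {p. \<forall>m \<in> Poly_Mapping.keys p. Poly_Mapping.keys m \<subseteq> W}"

definition homogeneous :: "nat \<Rightarrow> cpoly \<Rightarrow> bool" where
  "homogeneous d p \<longleftrightarrow> (\<forall>m \<in> Poly_Mapping.keys p.
     (\<Sum>v \<in> Poly_Mapping.keys m. Poly_Mapping.lookup m v) = d)"

definition peval :: "cpoly \<Rightarrow> complex mat \<Rightarrow> complex" where
  "peval p A = (\<Sum>m \<in> Poly_Mapping.keys p. Poly_Mapping.lookup p m *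
     (\<Prod>(i, j) \<in> Poly_Mapping.keys m. (A $$ (i - 1, j - 1)) ^ Poly_Mapping.lookup m (i, j)))"

definition coords :: "nat \<Rightarrow> (nat \<times> nat) set" where
  "coords N = {(i, j). 1 \<le> i \<and> i < j \<and> j \<le> N}"

definition coord_ring :: "nat \<Rightarrow> cpoly ring" where
  "coord_ring N = \<lparr>carrier = polys_in (coords N), monoid.mult = (*), one = 1,
     ring.zero = 0, add = (+)\<rparr>"


section \<open>Zariski topology\<close>

text \<open>
  The principal open sets are closed under finite intersections, so the open sets are exactly
  the unions of principal open sets.
\<close>

definition zariski :: "nat \<Rightarrow> complex mat topology" where
  "zariski N = topology_generated_by
     {{A \<in> strict_upper N. peval p A \<noteq> 0} | p. p \<in> polys_in (coords N)}"

definition irreducible_in :: "'a topology \<Rightarrow> 'a set \<Rightarrow> bool" where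
  "irreducible_in X S \<longleftrightarrow> S \<noteq> {} \<and> S \<subseteq> topspace X \<and>
     (\<forall>C D. closedin X C \<and> closedin X D \<and> S \<subseteq> C \<union> D \<longrightarrow> S \<subseteq> C \<or> S \<subseteq> D)"

definition irreducible_components :: "'a topology \<Rightarrow> 'a set \<Rightarrow> 'a set set" where
  "irreducible_components X Y = {S. S \<subseteq> Y \<and> irreducible_in X S \<and>
     (\<forall>S'. S' \<subseteq> Y \<and> irreducible_in X S' \<and> S \<subseteq> S' \<longrightarrow> S' = S)}"

definition codim :: "'a topology \<Rightarrow> 'a set \<Rightarrow> 'a set \<Rightarrow> enat" where
  "codim X Z Y = (SUP n \<in> {n. \<exists>F :: nat \<Rightarrow> 'a set. F 0 = Z \<and> F n = Y \<and>
     (\<forall>i\<le>n. closedin X (F i) \<and> irreducible_in X (F i)) \<and> (\<forall>i<n. F i \<subset> F (Suc i))}. enat n)"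

definition generically :: "'a topology \<Rightarrow> 'a set \<Rightarrow> ('a \<Rightarrow> bool) \<Rightarrow> bool" where
  "generically X S P \<longleftrightarrow> (\<exists>U. openin (subtopology X S) U \<and> U \<noteq> {} \<and> (\<forall>x\<in>U. P x))"


section \<open>Orbital varieties\<close>

definition partition_of :: "nat \<Rightarrow> nat list \<Rightarrow> bool" where
  "partition_of N lam \<longleftrightarrow> sorted_wrt (\<ge>) lam \<and> 0 \<notin> set lam \<and> sum_list lam = N"

definition has_jordan_type :: "complex mat \<Rightarrow> nat list \<Rightarrow> bool" where
  "has_jordan_type A lam \<longleftrightarrow> jordan_nf A (map (\<lambda>k. (k, 0)) lam)"

definition nilpotent_orbit :: "nat \<Rightarrow> nat list \<Rightarrow> complex mat set" where
  "nilpotent_orbit N lam = {A \<in> carrier_mat N N. has_jordan_type A lam}"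

definition orbital_variety :: "nat \<Rightarrow> complex mat set \<Rightarrow> bool" where
  "orbital_variety N V \<longleftrightarrow> (\<exists>lam. partition_of N lam \<and>
     V \<in> irreducible_components (zariski N) (nilpotent_orbit N lam \<inter> strict_upper N))"

definition GL :: "nat \<Rightarrow> complex mat monoid" where
  "GL N = units_of (ring_mat TYPE(complex) N ())"

text \<open>For \<open>i \<noteq> j\<close> the root subgroup is \<open>{exp (c E\<^sub>i\<^sub>j)} = {1 + c E\<^sub>i\<^sub>j}\<close>.\<close>

definition root_subgroup :: "nat \<Rightarrow> nat \<Rightarrow> nat \<Rightarrow> complex mat set" where
  "root_subgroup N i j = {1\<^sub>m N + c \<cdot>\<^sub>m munit N i j | c. True}"

definition tau :: "nat \<Rightarrow> complex mat set \<Rightarrow> nat set" where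
  "tau N V = {i \<in> {1..<N}.
     \<forall>g \<in> generate (GL N) (root_subgroup N i (i + 1) \<union> root_subgroup N (i + 1) i).
       (\<lambda>x. g * x * inv\<^bsub>GL N\<^esub> g) ` V = V}"

definition richardson_variety :: "nat \<Rightarrow> nat set \<Rightarrow> complex mat set \<Rightarrow> bool" where
  "richardson_variety N \<tau> V \<longleftrightarrow> orbital_variety N V \<and> tau N V = \<tau> \<and>
     zariski N closure_of V = richardson_space N \<tau>"

definition hypersurface_orbital_variety :: "nat \<Rightarrow> complex mat set \<Rightarrow> bool" where
  "hypersurface_orbital_variety N V \<longleftrightarrow> orbital_variety N V \<and>
     codim (zariski N) (zariski N closure_of V) (richardson_space N (tau N V)) = 1"


section \<open>The non-linear generator and its \<open>\<sigma>\<close>-set\<close>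

definition vanishing_ideal :: "nat \<Rightarrow> complex mat set \<Rightarrow> cpoly set" where
  "vanishing_ideal N Z = {p \<in> polys_in (coords N). \<forall>A\<in>Z. peval p A = 0}"

definition killed_coords :: "nat \<Rightarrow> nat set \<Rightarrow> (nat \<times> nat) set" where
  "killed_coords N \<tau> = {(s, t) \<in> coords N. pos_root s (t - 1) \<in> pos_roots_of N \<tau>}"

definition nonlinear_generator :: "nat \<Rightarrow> complex mat set \<Rightarrow> cpoly \<Rightarrow> bool" where
  "nonlinear_generator N V f \<longleftrightarrow>
     f \<in> polys_in (coords N - killed_coords N (tau N V)) \<and>
     Factorial_Ring.irreducible f \<and> (\<exists>d\<ge>2. homogeneous d f) \<and>
     vanishing_ideal N (zariski N closure_of V) =
       Idl\<^bsub>coord_ring N\<^esub> ({pvar s t | s t. (s, t) \<in> killed_coords N (tau N V)} \<union> {f})"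

inductive_set lie_subalgebra :: "nat \<Rightarrow> complex mat set \<Rightarrow> complex mat set"
  for N :: nat and S :: "complex mat set" where
  zero: "0\<^sub>m N N \<in> lie_subalgebra N S"
| gen: "A \<in> S \<Longrightarrow> A \<in> lie_subalgebra N S"
| add: "A \<in> lie_subalgebra N S \<Longrightarrow> B \<in> lie_subalgebra N S \<Longrightarrow> A + B \<in> lie_subalgebra N S"
| smult: "A \<in> lie_subalgebra N S \<Longrightarrow> c \<cdot>\<^sub>m A \<in> lie_subalgebra N S"
| bracket: "A \<in> lie_subalgebra N S \<Longrightarrow> B \<in> lie_subalgebra N S \<Longrightarrow>
    A * B - B * A \<in> lie_subalgebra N S"

definition n_sub :: "nat \<Rightarrow> nat set \<Rightarrow> complex mat set" where
  "n_sub N \<sigma> = lie_subalgebra N {munit N i (i + 1) | i. i \<in> \<sigma>}"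

text \<open>
  The identification of the symmetric algebra with the polynomial ring sends the root vector
  in position \<open>(i, j)\<close> to the variable \<open>x\<^sub>i\<^sub>j\<close>. The symmetric algebra of a subspace \<open>W\<close> is then
  the subalgebra generated by the linear forms corresponding to the elements of \<open>W\<close>.
\<close>

definition lin_form :: "nat \<Rightarrow> complex mat \<Rightarrow> cpoly" where
  "lin_form N A = (\<Sum>(i, j) \<in> coords N. pconst (A $$ (i - 1, j - 1)) * pvar i j)"

inductive_set sym_algebra :: "nat \<Rightarrow> complex mat set \<Rightarrow> cpoly set"
  for N :: nat and W :: "complex mat set" where
  const: "pconst c \<in> sym_algebra N W"
| lin: "A \<in> W \<Longrightarrow> lin_form N A \<in> sym_algebra N W"
| add: "p \<in> sym_algebra N W \<Longrightarrow> q \<in> sym_algebra N W \<Longrightarrow> p + q \<in> sym_algebra N W"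
| mult: "p \<in> sym_algebra N W \<Longrightarrow> q \<in> sym_algebra N W \<Longrightarrow> p * q \<in> sym_algebra N W"

definition connected_simple :: "nat \<Rightarrow> nat set \<Rightarrow> bool" where
  "connected_simple N \<sigma> \<longleftrightarrow> (\<exists>a b. 1 \<le> a \<and> a \<le> b \<and> b \<le> N - 1 \<and> \<sigma> = {a..b})"

definition sigma_set :: "nat \<Rightarrow> complex mat set \<Rightarrow> nat set \<Rightarrow> bool" where
  "sigma_set N V \<sigma> \<longleftrightarrow> (\<exists>f. nonlinear_generator N V f \<and>
     connected_simple N \<sigma> \<and> f \<in> sym_algebra N (n_sub N \<sigma>) \<and>
     (\<forall>\<sigma>'. connected_simple N \<sigma>' \<and> f \<in> sym_algebra N (n_sub N \<sigma>') \<longrightarrow> \<sigma> \<subseteq> \<sigma>'))"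


section \<open>Tableaux, chains and thickness\<close>

text \<open>A tableau is the list of its rows, from top to bottom.\<close>

definition standard_tableau :: "nat \<Rightarrow> nat list list \<Rightarrow> bool" where
  "standard_tableau N T \<longleftrightarrow> [] \<notin> set T \<and> distinct (concat T) \<and> set (concat T) = {1..N} \<and>
     (\<forall>r \<in> set T. sorted_wrt (<) r) \<and>
     (\<forall>i. Suc i < length T \<longrightarrow> length (T ! Suc i) \<le> length (T ! i) \<and>
        (\<forall>j < length (T ! Suc i). T ! i ! j < T ! Suc i ! j))"

definition tableau_shape :: "nat list list \<Rightarrow> nat list" where
  "tableau_shape T = map length T"

definition tableau_upto :: "nat \<Rightarrow> nat list list \<Rightarrow> nat list list" where
  "tableau_upto k T = filter (\<lambda>r. r \<noteq> []) (map (filter (\<lambda>e. e \<le> k)) T)"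

definition row_of :: "nat list list \<Rightarrow> nat \<Rightarrow> nat" where
  "row_of T e = (THE i. i < length T \<and> e \<in> set (T ! i))"

definition upper_left :: "nat \<Rightarrow> 'a mat \<Rightarrow> 'a mat" where
  "upper_left k A = mat k k (\<lambda>(i, j). A $$ (i, j))"

definition associated_tableau :: "nat \<Rightarrow> complex mat set \<Rightarrow> nat list list \<Rightarrow> bool" where
  "associated_tableau N V T \<longleftrightarrow> standard_tableau N T \<and>
     (\<forall>k \<in> {1..N}. generically (zariski N) V
        (\<lambda>x. has_jordan_type (upper_left k x) (tableau_shape (tableau_upto k T))))"

definition tau_chains :: "nat \<Rightarrow> nat set \<Rightarrow> nat set set" where
  "tau_chains N \<tau> = orbits
     ((sym_group N)\<lparr>carrier := generate (sym_group N) {transpose i (i + 1) | i. i \<in> \<tau>}\<rparr>)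
     {1..N} (\<lambda>g. g)"

definition moved_down :: "nat \<Rightarrow> nat list list \<Rightarrow> nat \<Rightarrow> nat list list \<Rightarrow> bool" where
  "moved_down N TR e T \<longleftrightarrow> row_of T e = row_of TR e + 1 \<and>
     (\<forall>e' \<in> {1..N} - {e}. row_of T e' = row_of TR e')"

definition thickness :: "nat \<Rightarrow> nat set \<Rightarrow> nat list list \<Rightarrow> nat list list \<Rightarrow> nat \<Rightarrow> bool" where
  "thickness N \<tau> TR T I \<longleftrightarrow> (\<exists>C \<in> tau_chains N \<tau>. moved_down N TR (Max C) T \<and> I = card C)"


section \<open>Generic matrix and minors\<close>

definition generic_matrix :: "nat \<Rightarrow> nat set \<Rightarrow> cpoly mat" where
  "generic_matrix N \<tau> = mat N N (\<lambda>(i, j).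
     if (i + 1, j + 1) \<in> coords N - killed_coords N \<tau> then pvar (i + 1) (j + 1) else 0)"

definition cMin :: "nat \<Rightarrow> nat \<Rightarrow> 'a mat \<Rightarrow> 'a mat" where
  "cMin N k y = mat (N - k) (N - k) (\<lambda>(i, j). y $$ (i, j + k))"

definition char_minor :: "nat \<Rightarrow> nat set \<Rightarrow> nat \<Rightarrow> cpoly poly" where
  "char_minor N \<tau> I =
     det (cMin N I (map_mat (\<lambda>p. [:p:]) (generic_matrix N \<tau>) + [:0, 1:] \<cdot>\<^sub>m 1\<^sub>m N))"

text \<open>Only meaningful for \<open>j \<le> N - I\<close>, since subtraction on \<open>nat\<close> truncates.\<close>

definition minor_coeff :: "nat \<Rightarrow> nat set \<Rightarrow> nat \<Rightarrow> nat \<Rightarrow> cpoly" where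
  "minor_coeff N \<tau> I j = coeff (char_minor N \<tau> I) (N - I - j)"

end

theory Submission
  imports Defs "HOL-Library.Product_Lexorder"
begin

text \<open>
  The \<open>(1, N)\<close> entry \<open>g\<close> of the top nonzero power of \<open>x\<^sub>R\<close> is, up to sign, the coefficient
  \<open>m\<close> with index \<open>\<lambda>\<^sub>1 - 1\<close>, because the minor of \<open>x\<^sub>R + t\<close> is an entry of its adjugate.
  Moving a singleton chain to the second row shortens the first row of the tableau, so
  \<open>x\<close> has one power less on \<open>V\<close> than on the Richardson space; hence every entry of that power,
  and \<open>g\<close> in particular, is divisible by \<open>f\<close>.
  Since \<open>f\<close> involves a variable of row 1 and one of column \<open>N\<close>, divisibility of the other entries
  forces the outer chains to be singletons. A singleton inner chain would split \<open>g\<close> as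
  \<open>g\<^sub>1 g\<^sub>2\<close>, and \<open>f\<close> would divide a factor that omits column \<open>N\<close> or row 1. So all inner chains
  have at least two elements, and then \<open>g\<close> is irreducible.
\<close>

section \<open>Polynomials\<close>

text \<open>The chains act as levels. The entry (i, j) of \<open>x\<^sub>R\<close> is nonzero only
  if j lies in a later chain than i, so the entries of its powers are sums over walks through
  strictly later and later chains. The top nonzero power has exponent L, one less than the number of
  chains, so each of its walks meets every chain exactly once. Hence the monomials of g are
  squarefree, with one variable for each pair of consecutive chains, and a factorization of g can be
  studied by asking which variables share a monomial. Vanishing on V turns into divisibility by f
  because f is the only generator of the ideal that survives when the coordinates inside the chains
  are set to zero. That f divides one of two factors of g comes from the irreducibility of V: f
  vanishes there, hence so does one of the factors. That an entry of a power is not zero, or does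
  not vanish on the Richardson space, is seen at the 0-1 matrix of a single walk.\<close>

lemma poly_mapping_sum_singles:
  fixes p :: "'a \<Rightarrow>\<^sub>0 'b :: comm_monoid_add"
  shows "(\<Sum>k\<in>Poly_Mapping.keys p. Poly_Mapping.single k (Poly_Mapping.lookup p k)) = p"
  by (rule poly_mapping_eqI)
     (auto simp: lookup_sum lookup_single when_def in_keys_iff)

text \<open>Zero is the single term with coefficient 0, so it has no case of its own.\<close>

lemma poly_mapping_add_induct [case_names single add]:
  fixes p :: "'a \<Rightarrow>\<^sub>0 'b :: comm_monoid_add"
  assumes single: "\<And>k c. P (Poly_Mapping.single k c)"
    and add: "\<And>p q. P p \<Longrightarrow> P q \<Longrightarrow> P (p + q)"
  shows "P p"
proof -
  have "P (\<Sum>k\<in>S. Poly_Mapping.single k (Poly_Mapping.lookup p k))" if "finite S" for S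
    using that
  proof (induction S)
    case empty
    show ?case using single[of undefined 0] by simp
  next
    case (insert x F)
    then show ?case by (simp add: single add)
  qed
  then show ?thesis
    using poly_mapping_sum_singles[of p] by (metis finite_keys)
qed

lemma poly_mapping_neq_0E:
  assumes "p \<noteq> (0 :: 'a \<Rightarrow>\<^sub>0 'b :: zero)"
  obtains k where "Poly_Mapping.lookup p k \<noteq> 0"
  using assms poly_mapping_eqI[of p 0] by auto

text \<open>A map on terms that is additive in the coefficient and multiplicative in monomial and
  coefficient jointly extends to an additive and multiplicative map on polynomials. The instances
  are evaluation at a matrix, setting a set of variables to zero, and a grading by weight.\<close>

locale monomial_map =
  fixes h :: "'m :: comm_monoid_add \<Rightarrow> 'c :: comm_ring_1 \<Rightarrow> 'b :: comm_ring_1"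
  assumes h_add: "h m (a + b) = h m a + h m b"
    and h_mult: "h (m + m') (a * b) = h m a * h m' b"
begin

definition ext :: "('m \<Rightarrow>\<^sub>0 'c) \<Rightarrow> 'b" where
  "ext p = (\<Sum>m\<in>Poly_Mapping.keys p. h m (Poly_Mapping.lookup p m))"

lemma h_zero [simp]: "h m 0 = 0"
  using h_add[of m 0 0] by simp

lemma ext_superset:
  "finite S \<Longrightarrow> Poly_Mapping.keys p \<subseteq> S \<Longrightarrow> ext p = (\<Sum>m\<in>S. h m (Poly_Mapping.lookup p m))"
  unfolding ext_def by (rule sum.mono_neutral_left) (auto simp: in_keys_iff)

lemma ext_add: "ext (p + q) = ext p + ext q"
proof -
  let ?S = "Poly_Mapping.keys p \<union> Poly_Mapping.keys q"
  have "ext r = (\<Sum>m\<in>?S. h m (Poly_Mapping.lookup r m))" if "r \<in> {p, q, p + q}" for r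
    using that keys_add[of p q] by (intro ext_superset) auto
  then show ?thesis
    by (simp add: lookup_add h_add sum.distrib)
qed

lemma ext_single [simp]: "ext (Poly_Mapping.single m c) = h m c"
  by (simp add: ext_def)

lemma ext_mult: "ext (p * q) = ext p * ext q"
proof (induction p rule: poly_mapping_add_induct)
  case (single k c)
  show ?case
    by (induction q rule: poly_mapping_add_induct)
       (simp_all add: mult_single h_mult ext_add distrib_left)
qed (simp add: ext_add distrib_right)

end

section \<open>Evaluation at matrices\<close>

definition mono_eval :: "complex mat \<Rightarrow> (nat \<times> nat \<Rightarrow>\<^sub>0 nat) \<Rightarrow> complex" where
  "mono_eval A m = (\<Prod>(i, j)\<in>Poly_Mapping.keys m. (A $$ (i - 1, j - 1)) ^ Poly_Mapping.lookup m (i, j))"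

lemma mono_eval_superset:
  assumes "finite S" "Poly_Mapping.keys m \<subseteq> S"
  shows "mono_eval A m = (\<Prod>(i, j)\<in>S. (A $$ (i - 1, j - 1)) ^ Poly_Mapping.lookup m (i, j))"
  unfolding mono_eval_def using assms
  by (intro prod.mono_neutral_left) (auto simp: in_keys_iff)

lemma mono_eval_add: "mono_eval A (m + m') = mono_eval A m * mono_eval A m'"
proof -
  let ?S = "Poly_Mapping.keys m \<union> Poly_Mapping.keys m'"
  have "mono_eval A k = (\<Prod>(i, j)\<in>?S. (A $$ (i - 1, j - 1)) ^ Poly_Mapping.lookup k (i, j))"
    if "k \<in> {m, m', m + m'}" for k
    using that keys_add[of m m'] by (intro mono_eval_superset) auto
  then show ?thesis
    by (simp add: lookup_add power_add prod.distrib case_prod_unfold)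
qed

global_interpretation peval: monomial_map "\<lambda>m c. c * mono_eval A m"
  rewrites "monomial_map.ext (\<lambda>m c. c * mono_eval A m) = (\<lambda>p. peval p A)"
  for A
proof -
  show *: "monomial_map (\<lambda>m c. c * mono_eval A m)"
    by unfold_locales (simp_all add: algebra_simps mono_eval_add)
  show "monomial_map.ext (\<lambda>m c. c * mono_eval A m) = (\<lambda>p. peval p A)"
    by (rule ext, unfold monomial_map.ext_def[OF *]) (simp only: peval_def mono_eval_def)
qed

lemmas peval_add = peval.ext_add and peval_mult = peval.ext_mult and peval_single = peval.ext_single

lemma peval_0 [simp]: "peval 0 A = 0"
  by (simp add: peval_def)

lemma peval_sum: "peval (sum f S) A = (\<Sum>x\<in>S. peval (f x) A)"
  by (induction S rule: infinite_finite_induct) (simp_all add: peval_add)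

lemma peval_1 [simp]: "peval 1 A = 1"
  using peval_single[of 0 1 A] by (simp add: mono_eval_def)

lemma peval_pvar: "peval (pvar i j) A = A $$ (i - 1, j - 1)"
  by (simp add: pvar_def peval_single mono_eval_def)

lemma polys_in_0 [simp]: "0 \<in> polys_in W"
  and polys_in_1 [simp]: "1 \<in> polys_in W"
  by (simp_all add: polys_in_def)

lemma polys_in_add: "p \<in> polys_in W \<Longrightarrow> q \<in> polys_in W \<Longrightarrow> p + q \<in> polys_in W"
  using keys_add[of p q] by (auto simp: polys_in_def)

lemma polys_in_mult:
  assumes "p \<in> polys_in W" "q \<in> polys_in W" 
  shows "p * q \<in> polys_in W"
proof -
  have "Poly_Mapping.keys m \<subseteq> W" if m: "m \<in> Poly_Mapping.keys (p * q)" for m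
  proof -
    obtain a b where "m = a + b" "a \<in> Poly_Mapping.keys p" "b \<in> Poly_Mapping.keys q"
      using m keys_mult[of p q] by blast
    then show ?thesis
      using assms keys_add[of a b] unfolding polys_in_def by blast
  qed
  then show ?thesis by (simp add: polys_in_def)
qed

lemma polys_in_mono: "p \<in> polys_in W \<Longrightarrow> W \<subseteq> W' \<Longrightarrow> p \<in> polys_in W'"
  by (auto simp: polys_in_def)

section \<open>Variables of products and factors\<close>

definition vars :: "cpoly \<Rightarrow> (nat \<times> nat) set" where
  "vars p = (\<Union>m\<in>Poly_Mapping.keys p. Poly_Mapping.keys m)"

lemma polys_in_iff_vars: "p \<in> polys_in W \<longleftrightarrow> vars p \<subseteq> W"
  by (auto simp: polys_in_def vars_def)

lemma vars_mult_subset: "vars (p * q) \<subseteq> vars p \<union> vars q"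
  using polys_in_mult[of p "vars p \<union> vars q" q] by (simp add: polys_in_iff_vars)

lemma vars_empty_imp_pconst:
  assumes "vars p = {}"
  obtains c where "p = pconst c"
proof
  have "Poly_Mapping.keys p \<subseteq> {0}"
    using assms by (auto simp: vars_def)
  then show "p = pconst (Poly_Mapping.lookup p 0)"
    unfolding pconst_def
    by (intro poly_mapping_eqI) (auto simp: lookup_single when_def in_keys_iff)
qed

lemma weight_hom:
  fixes wt :: "'m :: comm_monoid_add \<Rightarrow> nat"
  assumes "\<And>m m'. wt (m + m') = wt m + wt m'"
  shows "monomial_map (\<lambda>m c :: 'c :: comm_ring_1. monom (Poly_Mapping.single m c) (wt m))"
  by unfold_locales (simp_all add: assms mult_monom mult_single single_add add_monom)

text \<open>Replace each monomial m by m t^(wt m). The degree in t is then the largest weight that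
  occurs, and degrees add because the coefficients form an integral domain. So terms of top weight
  cannot all cancel in a product.\<close>

lemma keys_mult_weight:
  fixes p q :: cpoly and wt :: "(nat \<times> nat \<Rightarrow>\<^sub>0 nat) \<Rightarrow> nat"
  assumes wt: "\<And>m m'. wt (m + m') = wt m + wt m'"
    and m1: "m1 \<in> Poly_Mapping.keys p" and m2: "m2 \<in> Poly_Mapping.keys q"
  obtains m where "m \<in> Poly_Mapping.keys (p * q)" "wt m1 + wt m2 \<le> wt m"
proof -
  interpret H: monomial_map "\<lambda>m c :: complex. monom (Poly_Mapping.single m c) (wt m)"
    by (rule weight_hom) (rule wt)
  have coeff_ext: "Poly_Mapping.lookup (coeff (H.ext r) n) m
      = (if wt m = n then Poly_Mapping.lookup r m else 0)" for r n m
  proof -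
    have "Poly_Mapping.lookup (coeff (H.ext r) n) m
      = (\<Sum>k\<in>Poly_Mapping.keys r. if k = m then if wt m = n then Poly_Mapping.lookup r m else 0 else 0)"
      unfolding H.ext_def coeff_sum lookup_sum
      by (intro sum.cong) (auto simp: lookup_single when_def)
    then show ?thesis
      by (auto simp: in_keys_iff)
  qed
  have deg: "wt m \<le> degree (H.ext r) \<and> H.ext r \<noteq> 0" if "m \<in> Poly_Mapping.keys r" for m r
  proof -
    have "coeff (H.ext r) (wt m) \<noteq> 0"
      using coeff_ext[of r "wt m" m] that by (auto simp: in_keys_iff)
    then show ?thesis by (auto intro: le_degree)
  qed
  have "degree (H.ext (p * q)) = degree (H.ext p) + degree (H.ext q)"
    using deg m1 m2 by (simp add: H.ext_mult degree_mult_eq)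
  moreover have "H.ext (p * q) \<noteq> 0"
    using deg m1 m2 by (simp add: H.ext_mult)
  then have "lead_coeff (H.ext (p * q)) \<noteq> 0" by simp
  then obtain m where "Poly_Mapping.lookup (lead_coeff (H.ext (p * q))) m \<noteq> 0"
    by (rule poly_mapping_neq_0E)
  then have "m \<in> Poly_Mapping.keys (p * q)" "wt m = degree (H.ext (p * q))"
    unfolding coeff_ext by (auto simp: in_keys_iff split: if_splits)
  ultimately show ?thesis
    using deg[OF m1] deg[OF m2] by (intro that[of m]) auto
qed

text \<open>Take the exponent of the variable as the weight: multiplication by a nonzero polynomial
  cannot lower its maximum.\<close>

lemma vars_dvd:
  fixes p q :: cpoly
  assumes "p dvd q" "q \<noteq> 0"
  shows "vars p \<subseteq> vars q"
proof
  fix v assume "v \<in> vars p"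
  then obtain m1 where m1: "m1 \<in> Poly_Mapping.keys p" "v \<in> Poly_Mapping.keys m1"
    by (auto simp: vars_def)
  from assms obtain r where r: "q = p * r" by (elim dvdE)
  with assms have "r \<noteq> 0" by auto
  then obtain m2 where "m2 \<in> Poly_Mapping.keys r"
    by (metis poly_mapping_neq_0E in_keys_iff)
  from keys_mult_weight[of "\<lambda>m. Poly_Mapping.lookup m v", OF lookup_add m1(1) this]
  obtain m where "m \<in> Poly_Mapping.keys q"
    "Poly_Mapping.lookup m1 v + Poly_Mapping.lookup m2 v \<le> Poly_Mapping.lookup m v"
    unfolding r .
  moreover have "Poly_Mapping.lookup m1 v \<noteq> 0"
    using m1(2) by (simp add: in_keys_iff)
  ultimately have "m \<in> Poly_Mapping.keys q" "Poly_Mapping.lookup m v \<noteq> 0"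
    by auto
  then show "v \<in> vars q"
    by (auto simp: vars_def in_keys_iff intro!: bexI[of _ m])
qed

text \<open>The weight is the total exponent of v and w, counted once if v = w. If the product is
  squarefree, the conclusion says that v and w are distinct and share a monomial.\<close>

lemma vars_mult_common_monomial:
  fixes p q :: cpoly
  assumes "v \<in> vars p" "w \<in> vars q"
  obtains m where "m \<in> Poly_Mapping.keys (p * q)" "v \<noteq> w \<Longrightarrow> 2 \<le> Poly_Mapping.lookup m v + Poly_Mapping.lookup m w"
    "v = w \<Longrightarrow> 2 \<le> Poly_Mapping.lookup m v"
proof -
  obtain m1 m2 where m: "m1 \<in> Poly_Mapping.keys p" "v \<in> Poly_Mapping.keys m1"
    "m2 \<in> Poly_Mapping.keys q" "w \<in> Poly_Mapping.keys m2"
    using assms by (auto simp: vars_def)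
  let ?wt = "\<lambda>m :: nat \<times> nat \<Rightarrow>\<^sub>0 nat. if v = w then Poly_Mapping.lookup m v else Poly_Mapping.lookup m v + Poly_Mapping.lookup m w"
  have wt: "?wt (a + b) = ?wt a + ?wt b" for a b
    by (auto simp: lookup_add)
  from keys_mult_weight[of ?wt, OF wt m(1,3)]
  obtain k where k: "k \<in> Poly_Mapping.keys (p * q)" "?wt m1 + ?wt m2 \<le> ?wt k" .
  have "Poly_Mapping.lookup m1 v > 0" "Poly_Mapping.lookup m2 w > 0"
    using m by (auto simp: in_keys_iff)
  then show ?thesis
    using that[OF k(1)] k(2) by (auto split: if_splits)
qed

declare One_nat_def [simp del]

section \<open>Chains and paths\<close>

text \<open>\<open>lev \<tau> i\<close> is the number, counted from 0, of the chain that contains \<open>i\<close>.\<close>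

definition lev :: "nat set \<Rightarrow> nat \<Rightarrow> nat" where
  "lev \<tau> i = card {j \<in> {1..<i}. j \<notin> \<tau>}"

lemma lev_1 [simp]: "lev \<tau> 1 = 0"
  by (simp add: lev_def)

lemma lev_Suc:
  assumes "1 \<le> i"
  shows "lev \<tau> (Suc i) = lev \<tau> i + (if i \<in> \<tau> then 0 else 1)"
proof -
  have "{j \<in> {1..<Suc i}. j \<notin> \<tau>} = {j \<in> {1..<i}. j \<notin> \<tau>} \<union> (if i \<in> \<tau> then {} else {i})"
    using assms by (auto simp: less_Suc_eq)
  then show ?thesis by (simp add: lev_def)
qed

lemma lev_mono: "i \<le> j \<Longrightarrow> lev \<tau> i \<le> lev \<tau> j"
  unfolding lev_def by (rule card_mono) auto

lemma lev_less_imp_less: "lev \<tau> i < lev \<tau> j \<Longrightarrow> i < j"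
  using lev_mono[of j i \<tau>] by (meson not_less)

lemma lev_less: "lev \<tau> i < i" if "1 \<le> i"
proof -
  have "lev \<tau> i \<le> card {1..<i}"
    unfolding lev_def by (rule card_mono) auto
  with that show ?thesis by simp
qed

lemma lev_less_iff:
  assumes "1 \<le> i" "i < j"
  shows "lev \<tau> i < lev \<tau> j \<longleftrightarrow> \<not> {i..<j} \<subseteq> \<tau>"
  using assms(2)[folded Suc_le_eq]
proof (induction j rule: dec_induct)
  case base
  show ?case using assms(1) by (auto simp: lev_Suc)
next
  case (step n)
  then show ?case
    using assms(1) lev_mono[of i n \<tau>] by (auto simp: lev_Suc atLeastLessThanSuc split: if_splits)
qed

text \<open>The level grows by at most one from an index to the next, so no value is
  skipped.\<close>

lemma lev_surj:
  assumes "1 \<le> k" "l \<le> lev \<tau> k"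
  shows "\<exists>i. 1 \<le> i \<and> i \<le> k \<and> lev \<tau> i = l"
  using assms
proof (induction k rule: dec_induct)
  case base
  then show ?case by auto
next
  case (step n)
  show ?case
  proof (cases "l \<le> lev \<tau> n")
    case True
    then show ?thesis using step by (metis le_SucI)
  next
    case False
    then show ?thesis using step by (intro exI[of _ "Suc n"]) (auto simp: lev_Suc split: if_splits)
  qed
qed

text \<open>The coordinates of the Richardson space: position (i, j) survives iff j lies in a later
  chain than i. The inequality i < j is implied by the levels.\<close>

definition free_coords :: "nat \<Rightarrow> nat set \<Rightarrow> (nat \<times> nat) set" where
  "free_coords N \<tau> = {(i, j). 1 \<le> i \<and> j \<le> N \<and> lev \<tau> i < lev \<tau> j}"

lemma killed_iff:
  assumes "1 \<le> s" "s < t" "t \<le> N"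
  shows "pos_root s (t - 1) \<in> pos_roots_of N \<tau> \<longleftrightarrow> \<not> lev \<tau> s < lev \<tau> t"
proof -
  have "pos_root s (t - 1) \<in> pos_roots N"
    unfolding pos_roots_def using assms by (intro CollectI exI[of _ s] exI[of _ "t - 1"]) auto
  moreover have "{s..t - 1} = {s..<t}"
    using assms by auto
  ultimately show ?thesis
    using assms by (simp add: pos_roots_of_def lev_less_iff pos_root_def)
qed

lemma free_coords_eq: "coords N - killed_coords N \<tau> = free_coords N \<tau>"
  by (auto simp: free_coords_def coords_def killed_coords_def killed_iff lev_less_imp_less)

lemma richardson_space_iff:
  "A \<in> richardson_space N \<tau> \<longleftrightarrow> A \<in> carrier_mat N N \<and>
     (\<forall>i j. 1 \<le> i \<and> i \<le> N \<and> 1 \<le> j \<and> j \<le> N \<and> A $$ (i - 1, j - 1) \<noteq> 0 \<longrightarrow> lev \<tau> i < lev \<tau> j)"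
  (is "?L \<longleftrightarrow> ?R")
proof
  assume L: ?L
  then have su: "A \<in> strict_upper N"
    and k: "\<And>s t. 1 \<le> s \<Longrightarrow> s < t \<Longrightarrow> t \<le> N \<Longrightarrow> \<not> lev \<tau> s < lev \<tau> t \<Longrightarrow> A $$ (s - 1, t - 1) = 0"
    by (auto simp: richardson_space_def killed_iff)
  have "lev \<tau> i < lev \<tau> j"
    if h: "1 \<le> i" "i \<le> N" "1 \<le> j" "j \<le> N" "A $$ (i - 1, j - 1) \<noteq> 0" for i j
  proof -
    have "i < j"
    proof (rule ccontr)
      assume "\<not> i < j"
      with h have "i - 1 < N" "j - 1 < N" "j - 1 \<le> i - 1" by auto
      with su h(5) show False unfolding strict_upper_def by blast
    qed
    with k[of i j] h show ?thesis by blast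
  qed
  with su show ?R by (auto simp: strict_upper_def)
next
  assume R: ?R
  then have r: "\<And>i j. 1 \<le> i \<Longrightarrow> i \<le> N \<Longrightarrow> 1 \<le> j \<Longrightarrow> j \<le> N \<Longrightarrow> \<not> lev \<tau> i < lev \<tau> j \<Longrightarrow> A $$ (i - 1, j - 1) = 0"
    by blast
  have "A $$ (i, j) = 0" if "i < N" "j < N" "j \<le> i" for i j
    using r[of "Suc i" "Suc j"] that lev_mono[of "Suc j" "Suc i" \<tau>] by auto
  then have "A \<in> strict_upper N" using R by (auto simp: strict_upper_def)
  then show ?L
    using r by (auto simp: richardson_space_def killed_iff)
qed

lemma richardson_space_carrier: "A \<in> richardson_space N \<tau> \<Longrightarrow> A \<in> carrier_mat N N"
  by (simp add: richardson_space_iff)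

lemma upper_left_carrier [simp]: "upper_left k A \<in> carrier_mat k k"
  by (simp add: upper_left_def)

lemma upper_left_entry: "1 \<le> i \<Longrightarrow> i \<le> k \<Longrightarrow> 1 \<le> j \<Longrightarrow> j \<le> k \<Longrightarrow> upper_left k A $$ (i - 1, j - 1) = A $$ (i - 1, j - 1)"
  by (simp add: upper_left_def)

lemma upper_left_full: "A \<in> carrier_mat N N \<Longrightarrow> upper_left N A = A"
  by (auto simp: upper_left_def)

text \<open>\<open>lev \<tau> i\<close> depends only on the part of \<tau> below i, so the same
  \<tau> serves for a truncated matrix.\<close>

lemma upper_left_richardson: "A \<in> richardson_space N \<tau> \<Longrightarrow> k \<le> N \<Longrightarrow> upper_left k A \<in> richardson_space k \<tau>"
  by (auto simp: richardson_space_iff upper_left_entry)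

lemma generic_matrix_carrier [simp]: "generic_matrix N \<tau> \<in> carrier_mat N N"
  by (simp add: generic_matrix_def)

lemma generic_matrix_entry:
  assumes "1 \<le> i" "i \<le> N" "1 \<le> j" "j \<le> N"
  shows "generic_matrix N \<tau> $$ (i - 1, j - 1) = (if lev \<tau> i < lev \<tau> j then pvar i j else 0)"
  using assms unfolding generic_matrix_def free_coords_eq by (simp add: free_coords_def)

section \<open>Powers of the generic matrix as sums over walks\<close>

lemma pow_mat_Suc_entry:
  fixes A :: "'a :: semiring_1 mat"
  assumes A: "A \<in> carrier_mat N N" and ab: "1 \<le> a" "a \<le> N" "1 \<le> b" "b \<le> N"
  shows "(A ^\<^sub>m Suc n) $$ (a - 1, b - 1) = (\<Sum>c\<in>{1..N}. (A ^\<^sub>m n) $$ (a - 1, c - 1) * A $$ (c - 1, b - 1))"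
proof -
  have "(A ^\<^sub>m Suc n) $$ (a - 1, b - 1) = (\<Sum>c\<in>{0..<N}. (A ^\<^sub>m n) $$ (a - 1, c) * A $$ (c, b - 1))"
    using assms by (simp add: scalar_prod_def)
  also have "\<dots> = (\<Sum>c\<in>{1..N}. (A ^\<^sub>m n) $$ (a - 1, c - 1) * A $$ (c - 1, b - 1))"
    by (rule sum.reindex_bij_witness[of _ "\<lambda>c. c - 1" Suc]) auto
  finally show ?thesis .
qed

lemma pow_mat_0_entry:
  assumes A: "A \<in> carrier_mat N N" and ab: "1 \<le> a" "a \<le> N" "1 \<le> b" "b \<le> N"
  shows "(A ^\<^sub>m 0) $$ (a - 1, b - 1) = (if a = b then 1 else 0)"
  using assms by auto

text \<open>The generating polynomial of the walks of length n from a to b inside {1..k} with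
  strictly rising levels, each walk weighted by the product of its edge variables. Sizes k below N
  describe the upper-left corners that determine the tableau.\<close>

definition walk_poly :: "nat \<Rightarrow> nat set \<Rightarrow> nat \<Rightarrow> nat \<Rightarrow> nat \<Rightarrow> cpoly" where
  "walk_poly k \<tau> n a b = (generic_matrix k \<tau> ^\<^sub>m n) $$ (a - 1, b - 1)"

lemma walk_poly_0:
  "1 \<le> a \<Longrightarrow> a \<le> k \<Longrightarrow> 1 \<le> b \<Longrightarrow> b \<le> k \<Longrightarrow> walk_poly k \<tau> 0 a b = (if a = b then 1 else 0)"
  unfolding walk_poly_def by (rule pow_mat_0_entry) auto

lemma walk_poly_Suc:
  assumes "1 \<le> a" "a \<le> k" "1 \<le> b" "b \<le> k"
  shows "walk_poly k \<tau> (Suc n) a b =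
    (\<Sum>c\<in>{1..k}. walk_poly k \<tau> n a c * (if lev \<tau> c < lev \<tau> b then pvar c b else 0))"
  unfolding walk_poly_def using assms
  by (subst pow_mat_Suc_entry[of _ k]) (auto simp: generic_matrix_entry intro!: sum.cong)

lemma polys_in_sum: "(\<And>x. x \<in> S \<Longrightarrow> f x \<in> polys_in W) \<Longrightarrow> sum f S \<in> polys_in W"
  by (induction S rule: infinite_finite_induct) (auto intro: polys_in_add)

lemma polys_in_pvar: "(i, j) \<in> W \<Longrightarrow> pvar i j \<in> polys_in W"
  by (simp add: polys_in_def pvar_def)

lemma walk_poly_polys_in:
  assumes "1 \<le> a" "a \<le> k" "1 \<le> b" "b \<le> k"
  shows "walk_poly k \<tau> n a b \<in> polys_in (free_coords k \<tau>)"
  using assms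
proof (induction n arbitrary: b)
  case (Suc n)
  then show ?case
    by (auto simp: walk_poly_Suc free_coords_def intro!: polys_in_sum polys_in_mult polys_in_pvar)
qed (simp add: walk_poly_0)

lemma peval_walk_poly:
  assumes A: "A \<in> richardson_space N \<tau>" and k: "k \<le> N" and "1 \<le> a" "a \<le> k" "1 \<le> b" "b \<le> k"
  shows "peval (walk_poly k \<tau> n a b) A = (upper_left k A ^\<^sub>m n) $$ (a - 1, b - 1)"
  using assms(3-)
proof (induction n arbitrary: b)
  case 0
  then show ?case 
    by (subst pow_mat_0_entry[of _ k]) (auto simp: walk_poly_0)
next
  case (Suc n)
  have "peval (if lev \<tau> c < lev \<tau> b then pvar c b else 0) A = upper_left k A $$ (c - 1, b - 1)"
    if "c \<in> {1..k}" for c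
  proof -
    have "upper_left k A $$ (c - 1, b - 1) = A $$ (c - 1, b - 1)"
      using Suc.prems that by (intro upper_left_entry) auto
    moreover have "A $$ (c - 1, b - 1) = 0" if "\<not> lev \<tau> c < lev \<tau> b"
      using A \<open>c \<in> {1..k}\<close> that k Suc.prems unfolding richardson_space_iff
      by (meson atLeastAtMost_iff order_trans)
    ultimately show ?thesis by (auto simp: peval_pvar)
  qed
  then show ?case
    using Suc by (subst pow_mat_Suc_entry[of _ k]) 
      (auto simp: walk_poly_Suc peval_sum peval_mult intro!: sum.cong)
qed

definition walk :: "nat \<Rightarrow> nat set \<Rightarrow> nat \<Rightarrow> nat \<Rightarrow> nat \<Rightarrow> (nat \<Rightarrow> nat) \<Rightarrow> bool" where
  "walk k \<tau> n a b p \<longleftrightarrow> p 0 = a \<and> p n = b \<and> (\<forall>t\<le>n. 1 \<le> p t \<and> p t \<le> k) \<and>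
     (\<forall>t<n. lev \<tau> (p t) < lev \<tau> (p (Suc t)))"

definition walk_mono :: "(nat \<Rightarrow> nat) \<Rightarrow> nat \<Rightarrow> (nat \<times> nat \<Rightarrow>\<^sub>0 nat)" where
  "walk_mono p n = (\<Sum>t<n. Poly_Mapping.single (p t, p (Suc t)) 1)"

text \<open>Every monomial comes from a walk. The converse direction is handled later by evaluation
  at the matrix of a walk, which avoids any bookkeeping of coefficients.\<close>

lemma keys_walk_poly:
  assumes "m \<in> Poly_Mapping.keys (walk_poly k \<tau> n a b)" "1 \<le> a" "a \<le> k" "1 \<le> b" "b \<le> k"
  shows "\<exists>p. walk k \<tau> n a b p \<and> m = walk_mono p n"
  using assms
proof (induction n arbitrary: b m)
  case 0
  then show ?case
    by (intro exI[of _ "\<lambda>_. a"]) (auto simp: walk_poly_0 walk_def walk_mono_def split: if_splits)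
next
  case (Suc n)
  from Suc.prems(1) have "m \<in> (\<Union>c\<in>{1..k}. Poly_Mapping.keys
      (walk_poly k \<tau> n a c * (if lev \<tau> c < lev \<tau> b then pvar c b else 0)))"
    using keys_sum[of "\<lambda>c. walk_poly k \<tau> n a c * (if lev \<tau> c < lev \<tau> b then pvar c b else 0)" "{1..k}"]
    unfolding walk_poly_Suc[OF Suc.prems(2-)] by (rule rev_subsetD)
  then obtain c where c: "c \<in> {1..k}" and mc:
    "m \<in> Poly_Mapping.keys (walk_poly k \<tau> n a c * (if lev \<tau> c < lev \<tau> b then pvar c b else 0))"
    by (rule UN_E)
  from mc have less: "lev \<tau> c < lev \<tau> b"
    by (cases "lev \<tau> c < lev \<tau> b") simp_all
  with mc have "m \<in> Poly_Mapping.keys (walk_poly k \<tau> n a c * pvar c b)"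
    by simp
  then obtain m' where m': "m' \<in> Poly_Mapping.keys (walk_poly k \<tau> n a c)"
    and m: "m = m' + Poly_Mapping.single (c, b) 1"
    using keys_mult[of "walk_poly k \<tau> n a c" "pvar c b"] by (fastforce simp: pvar_def)
  obtain p where p: "walk k \<tau> n a c p" "m' = walk_mono p n"
    using Suc.IH[OF m'] Suc.prems(2,3) c by (meson atLeastAtMost_iff)
  have "walk k \<tau> (Suc n) a b (p(Suc n := b))"
    unfolding walk_def
  proof (intro conjI allI impI)
    show "(p(Suc n := b)) 0 = a" using p(1) by (simp add: walk_def)
    show "1 \<le> (p(Suc n := b)) t" "(p(Suc n := b)) t \<le> k" if "t \<le> Suc n" for t
      using p(1) Suc.prems that by (auto simp: walk_def le_Suc_eq)
    show "lev \<tau> ((p(Suc n := b)) t) < lev \<tau> ((p(Suc n := b)) (Suc t))" if "t < Suc n" for t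
      using p(1) less that by (cases "t = n") (auto simp: walk_def)
  qed simp
  moreover have "m = walk_mono (p(Suc n := b)) (Suc n)"
  proof -
    have "p n = c" using p(1) by (simp add: walk_def)
    then show ?thesis by (simp add: m p(2) walk_mono_def)
  qed
  ultimately show ?case by blast
qed

lemma walk_lev_ge:
  assumes "walk k \<tau> n a b p" "s \<le> t" "t \<le> n"
  shows "lev \<tau> (p s) + (t - s) \<le> lev \<tau> (p t)"
  using assms(2,3)
proof (induction t rule: dec_induct)
  case (step t)
  moreover have "lev \<tau> (p t) < lev \<tau> (p (Suc t))"
    using assms(1) step by (auto simp: walk_def)
  ultimately show ?case by simp
qed simp

text \<open>Each step climbs at least one level. If the length uses up the whole difference of
  levels, each step climbs exactly one.\<close>

lemma walk_lev_eq:
  assumes "walk k \<tau> n a b p" "lev \<tau> b \<le> lev \<tau> a + n" "t \<le> n"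
  shows "lev \<tau> (p t) = lev \<tau> a + t"
proof -
  have "p 0 = a" "p n = b" using assms(1) by (auto simp: walk_def)
  then show ?thesis
    using walk_lev_ge[OF assms(1), of 0 t] walk_lev_ge[OF assms(1), of t n] assms(2,3) by simp
qed

lemma walk_poly_eq_0:
  assumes "lev \<tau> b < lev \<tau> a + n" "1 \<le> a" "a \<le> k" "1 \<le> b" "b \<le> k"
  shows "walk_poly k \<tau> n a b = 0"
proof (rule ccontr)
  assume "walk_poly k \<tau> n a b \<noteq> 0"
  then obtain m where "m \<in> Poly_Mapping.keys (walk_poly k \<tau> n a b)"
    by (metis poly_mapping_neq_0E in_keys_iff)
  from keys_walk_poly[OF this assms(2-)] obtain p where p: "walk k \<tau> n a b p" by blast
  then have "p 0 = a" "p n = b" by (auto simp: walk_def)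
  with walk_lev_ge[OF p, of 0 n] assms(1) show False by simp
qed

lemma walk_inj:
  assumes "walk k \<tau> n a b p" "s \<le> n" "t \<le> n" "p s = p t"
  shows "s = t"
proof (rule ccontr)
  assume "s \<noteq> t"
  then show False
    using walk_lev_ge[OF assms(1), of s t] walk_lev_ge[OF assms(1), of t s] assms(2-)
    by (cases "s \<le> t") simp_all
qed

lemma lookup_walk_mono:
  "Poly_Mapping.lookup (walk_mono p n) v = card {t. t < n \<and> (p t, p (Suc t)) = v}"
  unfolding walk_mono_def lookup_sum
  by (simp add: lookup_single when_def sum.If_cases lessThan_def Collect_conj_eq[symmetric])

lemma keys_walk_mono: "Poly_Mapping.keys (walk_mono p n) = {(p t, p (Suc t)) | t. t < n}"
  by (auto simp: in_keys_iff lookup_walk_mono card_eq_0_iff)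

text \<open>Rising levels keep a walk from returning to a vertex, so no edge is used twice.\<close>

lemma lookup_walk_mono_le_1:
  assumes "walk k \<tau> n a b p"
  shows "Poly_Mapping.lookup (walk_mono p n) v \<le> 1"
proof -
  have "s = t" if "s < n" "t < n" "(p s, p (Suc s)) = v" "(p t, p (Suc t)) = v" for s t
  proof (rule walk_inj[OF assms])
    show "s \<le> n" "t \<le> n" "p s = p t" using that by auto
  qed
  then have "card {t. t < n \<and> (p t, p (Suc t)) = v} \<le> Suc 0"
    by (subst card_le_Suc0_iff_eq) auto
  then show ?thesis by (simp add: lookup_walk_mono One_nat_def)
qed

text \<open>The 0-1 matrix of the edges of one walk. It serves as a test point of the Richardson
  space at which the walk polynomial takes the value 1.\<close>

definition walk_matrix :: "nat \<Rightarrow> (nat \<Rightarrow> nat) \<Rightarrow> nat \<Rightarrow> complex mat" where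
  "walk_matrix k p n = mat k k (\<lambda>(i, j). if \<exists>t<n. Suc i = p t \<and> Suc j = p (Suc t) then 1 else 0)"

lemma walk_matrix_entry:
  assumes "1 \<le> i" "i \<le> k" "1 \<le> j" "j \<le> k"
  shows "walk_matrix k p n $$ (i - 1, j - 1) = (if \<exists>t<n. i = p t \<and> j = p (Suc t) then 1 else 0)"
  using assms by (simp add: walk_matrix_def)

lemma walk_matrix_carrier [simp]: "walk_matrix k p n \<in> carrier_mat k k"
  by (simp add: walk_matrix_def)

lemma walk_matrix_richardson:
  assumes "walk k \<tau> n a b p"
  shows "walk_matrix N p n \<in> richardson_space N \<tau>"
  using assms by (auto simp: richardson_space_iff walk_matrix_entry walk_def split: if_splits)

lemma upper_left_walk_matrix: "k \<le> N \<Longrightarrow> upper_left k (walk_matrix N p n) = walk_matrix k p n"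
  by (auto simp: upper_left_def walk_matrix_def)

text \<open>By injectivity of the walk, the only edge that leaves p t leads to p (Suc t). So row a
  of the t-th power is supported at p t alone.\<close>

lemma walk_matrix_pow:
  assumes w: "walk k \<tau> n a b p" and "t \<le> n" "1 \<le> c" "c \<le> k"
  shows "(walk_matrix k p n ^\<^sub>m t) $$ (a - 1, c - 1) = (if c = p t then 1 else 0)"
  using assms(2-)
proof (induction t arbitrary: c)
  case 0
  then show ?case
    using w by (subst pow_mat_0_entry[of _ k]) (auto simp: walk_def)
next
  case (Suc t)
  have a: "1 \<le> a" "a \<le> k" and pt: "p t \<in> {1..k}" using w Suc.prems by (auto simp: walk_def)
  have "(walk_matrix k p n ^\<^sub>m Suc t) $$ (a - 1, c - 1)
      = (\<Sum>d\<in>{1..k}. if d = p t then walk_matrix k p n $$ (d - 1, c - 1) else 0)"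
    unfolding pow_mat_Suc_entry[OF walk_matrix_carrier a Suc.prems(2,3)]
    using Suc by (intro sum.cong refl) auto
  also have "\<dots> = walk_matrix k p n $$ (p t - 1, c - 1)"
    using pt by simp
  also have "\<dots> = (if c = p (Suc t) then 1 else 0)"
  proof -
    have "(\<exists>s<n. p t = p s \<and> c = p (Suc s)) \<longleftrightarrow> c = p (Suc t)"
      using Suc.prems(1) walk_inj[OF w, of _ t] by (metis Suc_le_lessD less_imp_le)
    then show ?thesis
      using pt Suc.prems by (subst walk_matrix_entry) auto
  qed
  finally show ?case .
qed

lemma peval_walk_poly_walk_matrix:
  assumes w: "walk k \<tau> n a b p" and "k \<le> N"
  shows "peval (walk_poly k \<tau> n a b) (walk_matrix N p n) = 1"
proof -
  have "1 \<le> a \<and> a \<le> k \<and> 1 \<le> b \<and> b \<le> k \<and> b = p n" using w by (auto simp: walk_def)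
  then show ?thesis
    using walk_matrix_pow[OF w, of n b] assms
    by (simp add: peval_walk_poly[OF walk_matrix_richardson[OF w]] upper_left_walk_matrix)
qed

text \<open>Choosing one vertex from each of the levels 0 to n already gives a walk. Two vertices
  may therefore be prescribed, as long as they do not compete for the same level; x = y prescribes
  just one.\<close>

lemma level_walk:
  assumes "1 \<le> k" "n \<le> lev \<tau> k"
    and x: "1 \<le> x" "x \<le> k" "lev \<tau> x \<le> n" and y: "1 \<le> y" "y \<le> k" "lev \<tau> y \<le> n" "lev \<tau> x = lev \<tau> y \<Longrightarrow> x = y"
  obtains p where "walk k \<tau> n (p 0) (p n) p" "\<And>t. t \<le> n \<Longrightarrow> lev \<tau> (p t) = t" "p (lev \<tau> x) = x" "p (lev \<tau> y) = y"
proof -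
  have "\<forall>t. \<exists>i. t \<le> n \<longrightarrow> 1 \<le> i \<and> i \<le> k \<and> lev \<tau> i = t"
    using lev_surj[OF assms(1)] assms(2) le_trans by blast
  then obtain q where q: "\<And>t. t \<le> n \<Longrightarrow> 1 \<le> q t \<and> q t \<le> k \<and> lev \<tau> (q t) = t"
    by metis
  define p where "p t = (if t = lev \<tau> x then x else if t = lev \<tau> y then y else q t)" for t
  have p: "1 \<le> p t \<and> p t \<le> k \<and> lev \<tau> (p t) = t" if "t \<le> n" for t
    using q[OF that] x y by (auto simp: p_def)
  show ?thesis
  proof
    show "walk k \<tau> n (p 0) (p n) p"
      using p by (simp add: walk_def)
    show "lev \<tau> (p t) = t" if "t \<le> n" for t
      using p[OF that] by simp
    show "p (lev \<tau> x) = x" "p (lev \<tau> y) = y"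
      using y(4) by (auto simp: p_def)
  qed
qed

text \<open>The indices 1 to k occupy the levels 0 to \<open>lev \<tau> k\<close>, too few for a
  walk with \<open>lev \<tau> k + 1\<close> steps.\<close>

lemma richardson_pow_eq_0:
  assumes A: "A \<in> richardson_space k \<tau>"
  shows "A ^\<^sub>m Suc (lev \<tau> k) = 0\<^sub>m k k"
proof -
  have "(A ^\<^sub>m Suc (lev \<tau> k)) $$ (i, j) = 0" if ij: "i < k" "j < k" for i j
  proof -
    have "walk_poly k \<tau> (Suc (lev \<tau> k)) (Suc i) (Suc j) = 0"
      using ij lev_mono[of "Suc j" k \<tau>] by (intro walk_poly_eq_0) auto
    then show ?thesis
      using peval_walk_poly[OF A, of k "Suc i" "Suc j" "Suc (lev \<tau> k)"] ij upper_left_full[of A k] A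
      by (simp del: pow_mat.simps add: richardson_space_iff)
  qed
  then show ?thesis
    using richardson_space_carrier[OF A] pow_carrier_mat[of A k "Suc (lev \<tau> k)"]
    by (intro eq_matI) (auto simp del: pow_mat.simps)
qed

section \<open>Zariski density\<close>

lemma topspace_zariski [simp]: "topspace (zariski N) = strict_upper N"
proof -
  have "strict_upper N \<in> {{A \<in> strict_upper N. peval p A \<noteq> 0} | p. p \<in> polys_in (coords N)}"
    by (rule CollectI, rule exI[of _ 1]) simp
  then show ?thesis
    unfolding zariski_def topology_generated_by_topspace by blast
qed

lemma closedin_zero_set:
  assumes "p \<in> polys_in (coords N)"
  shows "closedin (zariski N) {A \<in> strict_upper N. peval p A = 0}"
proof -
  have "openin (zariski N) {A \<in> strict_upper N. peval p A \<noteq> 0}"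
    unfolding zariski_def by (rule topology_generated_by_Basis) (use assms in blast)
  moreover have "strict_upper N - {A \<in> strict_upper N. peval p A = 0} = {A \<in> strict_upper N. peval p A \<noteq> 0}"
    by blast
  ultimately show ?thesis
    by (simp add: closedin_def)
qed

text \<open>The two zero sets are closed and cover V, so one of them contains V. In the end this
  makes f behave like a prime on factorizations of g.\<close>

lemma irreducible_in_prime:
  assumes irr: "irreducible_in (zariski N) V"
    and p: "p \<in> polys_in (coords N)" and q: "q \<in> polys_in (coords N)"
    and pq: "\<And>A. A \<in> V \<Longrightarrow> peval (p * q) A = 0"
  shows "(\<forall>A\<in>V. peval p A = 0) \<or> (\<forall>A\<in>V. peval q A = 0)"
proof -
  have "V \<subseteq> {A \<in> strict_upper N. peval p A = 0} \<union> {A \<in> strict_upper N. peval q A = 0}"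
    using irr pq by (auto simp: irreducible_in_def peval_mult)
  with irr closedin_zero_set[OF p] closedin_zero_set[OF q]
  have "V \<subseteq> {A \<in> strict_upper N. peval p A = 0} \<or> V \<subseteq> {A \<in> strict_upper N. peval q A = 0}"
    unfolding irreducible_in_def by blast
  then show ?thesis by blast
qed

text \<open>V is covered by the zero set of p and the complement of a nonempty open part of V where
  P holds. Irreducibility leaves only the zero set.\<close>

lemma generically_vanishes:
  assumes irr: "irreducible_in (zariski N) V" and gen: "generically (zariski N) V P"
    and p: "p \<in> polys_in (coords N)"
    and vanish: "\<And>A. A \<in> V \<Longrightarrow> P A \<Longrightarrow> peval p A = 0"
    and A: "A \<in> V"
  shows "peval p A = 0"
proof -
  obtain U where U: "openin (subtopology (zariski N) V) U" "U \<noteq> {}" "\<forall>x\<in>U. P x"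
    using gen by (auto simp: generically_def)
  then obtain W where W: "openin (zariski N) W" "U = W \<inter> V"
    by (auto simp: openin_subtopology)
  have "closedin (zariski N) (topspace (zariski N) - W)"
    using W(1) by (simp only: closedin_diff closedin_topspace)
  moreover have "V \<subseteq> (topspace (zariski N) - W) \<union> {A \<in> strict_upper N. peval p A = 0}"
    using irr vanish U(3) W(2) by (auto simp: irreducible_in_def)
  moreover have "\<not> V \<subseteq> topspace (zariski N) - W"
    using U(2) W(2) by blast
  ultimately have "V \<subseteq> {A \<in> strict_upper N. peval p A = 0}"
    using irr closedin_zero_set[OF p] unfolding irreducible_in_def by blast
  then show ?thesis using A by blast
qed

lemma generically_witness:
  assumes "generically X V P"
  obtains x where "x \<in> V" "P x"
proof -
  obtain U where U: "openin (subtopology X V) U" "U \<noteq> {}" "\<forall>x\<in>U. P x"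
    using assms by (auto simp: generically_def)
  then have "U \<subseteq> V"
    by (metis openin_subset topspace_subtopology Int_subset_iff subset_trans)
  then show ?thesis using U that by blast
qed

lemma closure_vanishes:
  assumes p: "p \<in> polys_in (coords N)" and V: "V \<subseteq> strict_upper N"
    and "\<And>A. A \<in> V \<Longrightarrow> peval p A = 0" and "A \<in> Abstract_Topology.closure_of (zariski N) V"
  shows "peval p A = 0"
proof -
  have "Abstract_Topology.closure_of (zariski N) V \<subseteq> {A \<in> strict_upper N. peval p A = 0}"
    using assms(3) V by (intro closure_of_minimal closedin_zero_set p) auto
  then show ?thesis using assms(4) by blast
qed

lemma orbital_variety_irreducible: "orbital_variety N V \<Longrightarrow> irreducible_in (zariski N) V"
  by (auto simp: orbital_variety_def irreducible_components_def)

section \<open>Nilpotency index and tableaux\<close>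

lemma four_block_mat_eq_0_iff:
  assumes "A \<in> carrier_mat nr1 nc1" "D \<in> carrier_mat nr2 nc2"
  shows "four_block_mat A (0\<^sub>m nr1 nc2) (0\<^sub>m nr2 nc1) D = 0\<^sub>m (nr1 + nr2) (nc1 + nc2)
    \<longleftrightarrow> A = 0\<^sub>m nr1 nc1 \<and> D = 0\<^sub>m nr2 nc2" (is "?F = _ \<longleftrightarrow> _")
proof
  assume F: "?F = 0\<^sub>m (nr1 + nr2) (nc1 + nc2)"
  have "A $$ (i, j) = 0" if "i < nr1" "j < nc1" for i j
    using arg_cong[OF F, of "\<lambda>M. M $$ (i, j)"] that assms by simp
  moreover have "D $$ (i, j) = 0" if "i < nr2" "j < nc2" for i j
    using arg_cong[OF F, of "\<lambda>M. M $$ (i + nr1, j + nc1)"] that assms by simp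
  ultimately show "A = 0\<^sub>m nr1 nc1 \<and> D = 0\<^sub>m nr2 nc2"
    using assms by auto
qed auto

lemma diag_block_mat_eq_0_iff:
  "diag_block_mat Ms = 0\<^sub>m (sum_list (map dim_row Ms)) (sum_list (map dim_col Ms))
    \<longleftrightarrow> (\<forall>M\<in>set Ms. M = 0\<^sub>m (dim_row M) (dim_col M))"
proof (induction Ms)
  case (Cons M Ms)
  let ?D = "diag_block_mat Ms"
  have dim: "dim_row ?D = sum_list (map dim_row Ms)" "dim_col ?D = sum_list (map dim_col Ms)"
    by (simp_all add: dim_diag_block_mat)
  have "diag_block_mat (M # Ms)
      = four_block_mat M (0\<^sub>m (dim_row M) (dim_col ?D)) (0\<^sub>m (dim_row ?D) (dim_col M)) ?D"
    by (simp add: Let_def)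
  then show ?case
    using four_block_mat_eq_0_iff[OF carrier_matI[OF refl refl] carrier_matI[OF refl refl], of M ?D] Cons.IH
    unfolding dim[symmetric] by (metis list.simps(9) sum_list.Cons list.set_intros set_ConsD dim)
qed simp

lemma jordan_block_0_pow_eq_0_iff:
  assumes "0 < n"
  shows "(jordan_block n (0 :: 'a :: field)) ^\<^sub>m r = 0\<^sub>m n n \<longleftrightarrow> n \<le> r"
proof
  assume *: "(jordan_block n (0 :: 'a)) ^\<^sub>m r = 0\<^sub>m n n"
  show "n \<le> r"
  proof (rule ccontr)
    assume "\<not> n \<le> r"
    then show False
      using arg_cong[OF *, of "\<lambda>M. M $$ (0, r)"] assms by (simp add: jordan_block_zero_pow)
  qed
qed (auto simp: jordan_block_zero_pow intro!: eq_matI)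

lemma jordan_matrix_0_pow_eq_0_iff:
  assumes "0 \<notin> set lam"
  shows "jordan_matrix (map (\<lambda>k. (k, 0 :: 'a :: field)) lam) ^\<^sub>m r = 0\<^sub>m (sum_list lam) (sum_list lam)
    \<longleftrightarrow> (\<forall>k\<in>set lam. k \<le> r)"
proof -
  define Ms where "Ms = map (\<lambda>k. jordan_block k (0 :: 'a) ^\<^sub>m r) lam"
  have dim: "map dim_row Ms = lam" "map dim_col Ms = lam"
    by (simp_all add: Ms_def map_idI)
  have "jordan_matrix (map (\<lambda>k. (k, 0 :: 'a)) lam) ^\<^sub>m r = diag_block_mat Ms"
    by (simp add: jordan_matrix_pow Ms_def comp_def)
  moreover have "(\<forall>M\<in>set Ms. M = 0\<^sub>m (dim_row M) (dim_col M)) \<longleftrightarrow> (\<forall>k\<in>set lam. k \<le> r)"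
  proof -
    have "jordan_block k (0 :: 'a) ^\<^sub>m r = 0\<^sub>m k k \<longleftrightarrow> k \<le> r" if "k \<in> set lam" for k
      using that assms by (intro jordan_block_0_pow_eq_0_iff) (metis gr0I)
    then show ?thesis
      by (simp only: Ms_def set_map ball_simps jordan_block_pow_dim cong: ball_cong)
  qed
  ultimately show ?thesis
    using diag_block_mat_eq_0_iff[of Ms] unfolding dim by simp
qed

lemma has_jordan_type_pow_eq_0_iff:
  assumes "has_jordan_type A lam" "A \<in> carrier_mat n n"
  shows "A ^\<^sub>m r = 0\<^sub>m n n \<longleftrightarrow> (\<forall>k\<in>set lam. k \<le> r)"
proof -
  let ?J = "jordan_matrix (map (\<lambda>k. (k, 0 :: complex)) lam)"
  have lam: "0 \<notin> set lam" and sim: "similar_mat A ?J"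
    using assms(1) by (auto simp: has_jordan_type_def jordan_nf_def image_image)
  then obtain P Q where wit0: "similar_mat_wit A ?J P Q"
    unfolding similar_mat_def by blast
  then have wit: "similar_mat_wit (A ^\<^sub>m r) (?J ^\<^sub>m r) P Q"
    by (rule similar_mat_wit_pow)
  have J: "?J \<in> carrier_mat n n"
    using similar_mat_witD2[OF assms(2) wit0] by blast
  have "dim_row ?J = sum_list lam"
    by (simp add: comp_def)
  with carrier_matD(1)[OF J] have "sum_list lam = n" by metis
  moreover have "A ^\<^sub>m r = 0\<^sub>m n n \<longleftrightarrow> ?J ^\<^sub>m r = 0\<^sub>m n n"
  proof -
    have "M' = 0\<^sub>m n n" if "similar_mat_wit M' M X Y" "M' \<in> carrier_mat n n" "M = 0\<^sub>m n n" for M M' X Y :: "complex mat"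
    proof -
      have "M' = X * M * Y" "X \<in> carrier_mat n n" "Y \<in> carrier_mat n n"
        using similar_mat_witD2[OF that(2,1)] by blast+
      then show ?thesis using that(3) by simp
    qed
    note this[OF wit pow_carrier_mat[OF assms(2)]]
      this[OF similar_mat_wit_sym[OF wit] pow_carrier_mat[OF J]]
    then show ?thesis by blast
  qed
  ultimately show ?thesis
    using jordan_matrix_0_pow_eq_0_iff[OF lam, of r, where 'a = complex] by simp
qed

text \<open>For a standard tableau and k between 1 and N this is the largest part of the shape of
  \<open>tableau_upto k T\<close>, that is, the nilpotency index of any k by k matrix whose Jordan
  type is that shape.\<close>

definition first_row_upto :: "nat \<Rightarrow> nat list list \<Rightarrow> nat" where
  "first_row_upto k T = length (filter (\<lambda>e. e \<le> k) (hd T))"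

text \<open>Columns increase downwards, so above every entry at most k stands another one.\<close>

lemma standard_tableau_filter_mono:
  assumes T: "standard_tableau N T" and "i < length T"
  shows "length (filter (\<lambda>e. e \<le> k) (T ! i)) \<le> length (filter (\<lambda>e. e \<le> k) (T ! 0))"
  using assms(2)
proof (induction i)
  case (Suc i)
  have row: "length (T ! Suc i) \<le> length (T ! i)"
    "\<And>j. j < length (T ! Suc i) \<Longrightarrow> T ! i ! j < T ! Suc i ! j"
    using T Suc.prems by (auto simp: standard_tableau_def)
  have "{j. j < length (T ! Suc i) \<and> T ! Suc i ! j \<le> k} \<subseteq> {j. j < length (T ! i) \<and> T ! i ! j \<le> k}"
    using row by fastforce
  then have "length (filter (\<lambda>e. e \<le> k) (T ! Suc i)) \<le> length (filter (\<lambda>e. e \<le> k) (T ! i))"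
    unfolding length_filter_conv_card by (rule card_mono[rotated]) simp
  with Suc show ?case by simp
qed simp

lemma standard_tableau_nonempty:
  assumes "standard_tableau N T" "1 \<le> N"
  shows "T \<noteq> []"
  using assms by (auto simp: standard_tableau_def)

lemma tableau_shape_upto:
  assumes T: "standard_tableau N T" and k: "1 \<le> k" "k \<le> N"
  shows "first_row_upto k T \<in> set (tableau_shape (tableau_upto k T))"
    and "\<forall>r\<in>set (tableau_shape (tableau_upto k T)). r \<le> first_row_upto k T"
    and "1 \<le> first_row_upto k T"
proof -
  have ne: "T \<noteq> []" using standard_tableau_nonempty[OF T] k by simp
  then have hd: "hd T = T ! 0" by (simp add: hd_conv_nth)
  have le: "length (filter (\<lambda>e. e \<le> k) R) \<le> first_row_upto k T" if "R \<in> set T" for R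
    using that standard_tableau_filter_mono[OF T] unfolding first_row_upto_def hd in_set_conv_nth by blast
  have "1 \<in> set (concat T)" using T k by (auto simp: standard_tableau_def)
  then obtain R where R: "R \<in> set T" "1 \<in> set R" by auto
  then have "1 \<in> set (filter (\<lambda>e. e \<le> k) R)" using k by simp
  then have "length (filter (\<lambda>e. e \<le> k) R) \<noteq> 0" by (metis length_0_conv empty_iff list.set(1))
  with le[OF R(1)] show ge: "1 \<le> first_row_upto k T" by linarith
  show "\<forall>r\<in>set (tableau_shape (tableau_upto k T)). r \<le> first_row_upto k T"
    using le by (auto simp: tableau_shape_def tableau_upto_def)
  have "filter (\<lambda>e. e \<le> k) (hd T) \<noteq> []"
    using ge by (auto simp: first_row_upto_def)
  then have "filter (\<lambda>e. e \<le> k) (hd T) \<in> set (tableau_upto k T)"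
    using ne by (auto simp: tableau_upto_def)
  then show "first_row_upto k T \<in> set (tableau_shape (tableau_upto k T))"
    unfolding tableau_shape_def first_row_upto_def by simp
qed

lemma tableau_type_pow_eq_0_iff:
  assumes "standard_tableau N T" "1 \<le> k" "k \<le> N"
    and "has_jordan_type M (tableau_shape (tableau_upto k T))" "M \<in> carrier_mat k k"
  shows "M ^\<^sub>m r = 0\<^sub>m k k \<longleftrightarrow> first_row_upto k T \<le> r"
  using has_jordan_type_pow_eq_0_iff[OF assms(4,5)] tableau_shape_upto[OF assms(1-3)]
  by (meson order_trans)

lemma free_coords_subset: "k \<le> N \<Longrightarrow> free_coords k \<tau> \<subseteq> coords N"
  by (auto simp: free_coords_def coords_def lev_less_imp_less)

text \<open>Both sides are the generic nilpotency index of the upper-left k by k corner. It cannot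
  exceed the number of levels. If it were some r at most \<open>lev \<tau> k\<close>, a walk
  polynomial of length r would vanish on \<open>VR\<close>, hence on its closure, the whole
  Richardson space, although it equals 1 at the matrix of its walk.\<close>

lemma first_row_upto_richardson:
  assumes VR: "richardson_variety N \<tau> VR" and T: "associated_tableau N VR TR"
    and k: "1 \<le> k" "k \<le> N"
  shows "first_row_upto k TR = Suc (lev \<tau> k)"
proof -
  have irr: "irreducible_in (zariski N) VR"
    using VR orbital_variety_irreducible by (simp add: richardson_variety_def)
  have cl: "Abstract_Topology.closure_of (zariski N) VR = richardson_space N \<tau>"
    using VR by (simp add: richardson_variety_def)
  have su: "VR \<subseteq> strict_upper N"
    using irr by (simp add: irreducible_in_def)
  then have sub: "VR \<subseteq> richardson_space N \<tau>"
    using closure_of_subset[of VR "zariski N"] cl by simp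
  have std: "standard_tableau N TR"
    and gen: "generically (zariski N) VR
        (\<lambda>x. has_jordan_type (upper_left k x) (tableau_shape (tableau_upto k TR)))"
    using T k by (auto simp: associated_tableau_def)
  note pow_iff = tableau_type_pow_eq_0_iff[OF std k _ upper_left_carrier]
  obtain x where x: "x \<in> VR" "has_jordan_type (upper_left k x) (tableau_shape (tableau_upto k TR))"
    using generically_witness[OF gen] .
  have "upper_left k x ^\<^sub>m Suc (lev \<tau> k) = 0\<^sub>m k k"
    using x(1) sub k by (intro richardson_pow_eq_0 upper_left_richardson) auto
  then have le: "first_row_upto k TR \<le> Suc (lev \<tau> k)"
    using pow_iff[OF x(2)] by blast
  have "\<not> first_row_upto k TR \<le> lev \<tau> k"
  proof
    define r where "r = first_row_upto k TR"
    assume "first_row_upto k TR \<le> lev \<tau> k"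
    then have r: "r \<le> lev \<tau> k" by (simp add: r_def)
    \<comment> \<open>Any walk through the levels 0 to r will do; the vertex 1 of level 0 is
      prescribed as a placeholder.\<close>
    have "\<exists>p. walk k \<tau> r (p 0) (p r) p"
    proof (rule level_walk[of k r \<tau> 1 1])
      show "\<exists>p. walk k \<tau> r (p 0) (p r) p" if "walk k \<tau> r (p 0) (p r) p" for p
        using that by blast
    qed (use k r in simp_all)
    then obtain p where p: "walk k \<tau> r (p 0) (p r) p" ..
    define q where "q = walk_poly k \<tau> r (p 0) (p r)"
    have ab: "1 \<le> p 0" "p 0 \<le> k" "1 \<le> p r" "p r \<le> k"
      using p by (auto simp: walk_def)
    have q: "q \<in> polys_in (coords N)"
      unfolding q_def using walk_poly_polys_in[OF ab] free_coords_subset[OF k(2)]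
      by (rule polys_in_mono)
    have "peval q A = 0" if "A \<in> VR" "has_jordan_type (upper_left k A) (tableau_shape (tableau_upto k TR))" for A
    proof -
      have "upper_left k A ^\<^sub>m r = 0\<^sub>m k k"
        using pow_iff[OF that(2)] by (simp add: r_def)
      then show ?thesis
        unfolding q_def using that(1) sub ab k by (subst peval_walk_poly[where N = N]) auto
    qed
    then have "peval q A = 0" if "A \<in> VR" for A
      using generically_vanishes[OF irr gen q] that by blast
    then have "peval q (walk_matrix N p r) = 0"
      using closure_vanishes[OF q su] walk_matrix_richardson[OF p] cl by blast
    then show False
      using peval_walk_poly_walk_matrix[OF p k(2)] by (simp add: q_def)
  qed
  with le show ?thesis by simp
qed

text \<open>A singleton orbit is fixed by every generating transposition. The left neighbour is
  recorded because its absence from \<tau> makes the level rise at e.\<close>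

lemma singleton_chain:
  assumes C: "C \<in> tau_chains N \<tau>" "card C = 1" and \<tau>: "\<tau> \<subseteq> {1..<N}"
  obtains e where "C = {e}" "1 \<le> e" "e \<le> N" "e - 1 \<notin> \<tau>"
proof -
  let ?S = "{transpose i (i + 1) | i. i \<in> \<tau>}"
  let ?G = "(sym_group N)\<lparr>carrier := generate (sym_group N) ?S\<rparr>"
  obtain e where e: "e \<in> {1..N}" "C = orbit ?G (\<lambda>g. g) e"
    using C(1) by (auto simp: tau_chains_def orbits_def)
  have mem: "g e \<in> C" if "g \<in> generate (sym_group N) ?S" for g
    using that e(2) by (auto simp: orbit_def)
  have "e \<in> C"
    using mem[OF generate.one] by (simp add: sym_group_def)
  with C(2) have Ce: "C = {e}"
    by (metis card_1_singletonE singletonD One_nat_def)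
  have "e - 1 \<notin> \<tau>"
  proof
    assume i: "e - 1 \<in> \<tau>"
    then have "1 \<le> e - 1" using \<tau> by auto
    have "transpose (e - 1) (e - 1 + 1) e \<in> C"
      using i by (intro mem generate.incl) blast
    then show False
      using Ce \<open>1 \<le> e - 1\<close> by (auto simp: transpose_def split: if_splits)
  qed
  with Ce e(1) show ?thesis by (intro that) auto
qed

lemma standard_tableau_row_of:
  assumes T: "standard_tableau N T" and "i < length T" "e \<in> set (T ! i)"
  shows "row_of T e = i"
proof -
  have "j = i" if "j < length T" "e \<in> set (T ! j)" for j
  proof (rule ccontr)
    assume "j \<noteq> i"
    have "distinct (concat T)" "[] \<notin> set T" using T by (auto simp: standard_tableau_def)
    then have "distinct T" and disj: "\<And>R R'. R \<in> set T \<Longrightarrow> R' \<in> set T \<Longrightarrow> R \<noteq> R' \<Longrightarrow> set R \<inter> set R' = {}"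
      by (auto simp: distinct_concat_iff removeAll_id)
    then have "T ! i \<noteq> T ! j"
      using \<open>j \<noteq> i\<close> assms(2) that(1) by (simp add: nth_eq_iff_index_eq)
    then show False
      using disj[of "T ! i" "T ! j"] assms that by auto
  qed
  then show ?thesis
    unfolding row_of_def using assms(2,3) by (intro the_equality) blast+
qed

lemma standard_tableau_first_row:
  assumes T: "standard_tableau N T" and N: "1 \<le> N"
  shows "set (hd T) = {e \<in> {1..N}. row_of T e = 0}" "distinct (hd T)"
    "first_row_upto N T = length (hd T)"
proof -
  have hd: "hd T = T ! 0" "0 < length T"
    using standard_tableau_nonempty[OF T N] hd_conv_nth[of T] by simp_all
  have set_T: "set (concat T) = {1..N}" using T by (simp add: standard_tableau_def)
  then have sub: "set (hd T) \<subseteq> {1..N}"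
    using hd nth_mem[OF hd(2)] by auto
  show "set (hd T) = {e \<in> {1..N}. row_of T e = 0}"
  proof (intro equalityI subsetI)
    fix e assume "e \<in> {e \<in> {1..N}. row_of T e = 0}"
    then have "e \<in> set (concat T)" "row_of T e = 0" using set_T by auto
    then obtain R where "R \<in> set T" "e \<in> set R" by auto
    then obtain i where "i < length T" "e \<in> set (T ! i)"
      by (metis in_set_conv_nth)
    with standard_tableau_row_of[OF T this] \<open>row_of T e = 0\<close> show "e \<in> set (hd T)"
      using hd by simp
  next
    fix e assume "e \<in> set (hd T)"
    then show "e \<in> {e \<in> {1..N}. row_of T e = 0}"
      using sub standard_tableau_row_of[OF T hd(2)] hd(1) by auto
  qed
  show "distinct (hd T)"
    using T hd by (auto simp: standard_tableau_def distinct_concat_iff)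
  show "first_row_upto N T = length (hd T)"
    using sub by (auto simp: first_row_upto_def intro!: arg_cong[of _ _ length] filter_True)
qed

text \<open>The level rises at e, so by \<open>first_row_upto_richardson\<close> the first row of
  \<open>TR\<close> gains a box there, and this box is e. Moving it down leaves the first row of T
  one box shorter.\<close>

lemma first_row_after_move:
  assumes VR: "richardson_variety N \<tau> VR" and TR: "associated_tableau N VR TR"
    and th: "thickness N \<tau> TR T 1" and T: "standard_tableau N T" and N: "1 \<le> N" and \<tau>: "\<tau> \<subseteq> {1..<N}"
  shows "first_row_upto N T = lev \<tau> N"
proof -
  have stdR: "standard_tableau N TR" using TR by (simp add: associated_tableau_def)
  obtain C where C: "C \<in> tau_chains N \<tau>" "moved_down N TR (Max C) T" "card C = 1"
    using th by (auto simp: thickness_def)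
  obtain e where e: "C = {e}" "1 \<le> e" "e \<le> N" "e - 1 \<notin> \<tau>"
    using singleton_chain[OF C(1,3) \<tau>] .
  have mv: "row_of T e = row_of TR e + 1" "\<And>e'. e' \<in> {1..N} - {e} \<Longrightarrow> row_of T e' = row_of TR e'"
    using C(2) e by (auto simp: moved_down_def)
  have "e \<in> set (hd TR)"
  proof (rule ccontr)
    assume ne: "e \<notin> set (hd TR)"
    then have eq: "filter (\<lambda>x. x \<le> e) (hd TR) = filter (\<lambda>x. x \<le> e - 1) (hd TR)"
      by (intro filter_cong) (auto simp: le_less less_Suc_eq_le[symmetric])
    show False
    \<comment> \<open>For e = 1 there is no corner of size e - 1 to compare with; instead, the first
      row up to 1 would be empty.\<close>
    proof (cases "e = 1")
      case True
      have "set (filter (\<lambda>x. x \<le> e - 1) (hd TR)) = {}"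
        using standard_tableau_first_row(1)[OF stdR N] True by auto
      then have "first_row_upto e TR = 0" using eq by (simp add: first_row_upto_def)
      then show False using tableau_shape_upto(3)[OF stdR, of e] e by simp
    next
      case False
      then have "lev \<tau> e = Suc (lev \<tau> (e - 1))"
        using lev_Suc[of "e - 1" \<tau>] e by simp
      moreover have "first_row_upto e TR = first_row_upto (e - 1) TR"
        using eq by (simp add: first_row_upto_def)
      ultimately show False
        using first_row_upto_richardson[OF VR TR, of e] first_row_upto_richardson[OF VR TR, of "e - 1"] e False
        by simp
    qed
  qed
  moreover have "row_of T x = 0 \<longleftrightarrow> x \<noteq> e \<and> row_of TR x = 0" if "x \<in> {1..N}" for x
    using mv that by (cases "x = e") auto
  then have "set (hd T) = set (hd TR) - {e}"
    unfolding standard_tableau_first_row(1)[OF stdR N] standard_tableau_first_row(1)[OF T N] by blast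
  ultimately have "length (hd T) = length (hd TR) - 1"
    using standard_tableau_first_row(2)[OF stdR N] standard_tableau_first_row(2)[OF T N]
    by (metis card_Diff_singleton distinct_card)
  then show ?thesis
    using first_row_upto_richardson[OF VR TR N order_refl]
      standard_tableau_first_row(3)[OF stdR N] standard_tableau_first_row(3)[OF T N] by simp
qed

lemma hd_tableau_shape:
  assumes VR: "richardson_variety N \<tau> VR" and TR: "associated_tableau N VR TR" and N: "1 \<le> N"
  shows "hd (tableau_shape TR) = Suc (lev \<tau> N)"
proof -
  have stdR: "standard_tableau N TR" using TR by (simp add: associated_tableau_def)
  then show ?thesis
    using first_row_upto_richardson[OF VR TR N order_refl] standard_tableau_first_row(3)[OF stdR N]
      standard_tableau_nonempty[OF stdR N] by (simp add: tableau_shape_def hd_map)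
qed

section \<open>Divisibility by the non-linear generator\<close>

lemma keys_add_nat: "Poly_Mapping.keys (m + m') = Poly_Mapping.keys m \<union> Poly_Mapping.keys (m' :: 'a \<Rightarrow>\<^sub>0 nat)"
  by (auto simp: in_keys_iff lookup_add)

global_interpretation kill: monomial_map
    "\<lambda>m c. if Poly_Mapping.keys m \<inter> K = {} then Poly_Mapping.single m c else (0 :: cpoly)"
  for K
  defines kill = kill.ext
  by unfold_locales (auto simp: single_add mult_single keys_add_nat)

lemma kill_id:
  assumes "vars p \<inter> K = {}"
  shows "kill K p = p"
proof -
  have "kill K p = (\<Sum>m\<in>Poly_Mapping.keys p. Poly_Mapping.single m (Poly_Mapping.lookup p m))"
    unfolding kill.ext_def using assms by (intro sum.cong) (auto simp: vars_def)
  then show ?thesis by (simp add: poly_mapping_sum_singles)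
qed

lemma polys_in_uminus: "p \<in> polys_in W \<Longrightarrow> - p \<in> polys_in W"
  by (simp add: polys_in_def in_keys_iff)

lemma ring_coord_ring: "ring (coord_ring N)"
proof (rule ringI)
  show "abelian_group (coord_ring N)"
  proof (rule abelian_groupI)
    fix x assume "x \<in> carrier (coord_ring N)"
    then show "\<exists>y\<in>carrier (coord_ring N). y \<oplus>\<^bsub>coord_ring N\<^esub> x = \<zero>\<^bsub>coord_ring N\<^esub>"
      by (intro bexI[of _ "- x"]) (simp_all add: coord_ring_def polys_in_uminus)
  qed (auto simp: coord_ring_def polys_in_add algebra_simps)
  show "Group.monoid (coord_ring N)"
    by unfold_locales (auto simp: coord_ring_def polys_in_mult algebra_simps)
qed (auto simp: coord_ring_def algebra_simps)

text \<open>This is the preimage of the principal ideal of f under the homomorphism that sets the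
  variables in K to zero.\<close>

lemma ideal_dvd_kill: "ideal {p \<in> polys_in (coords N). f dvd kill K p} (coord_ring N)"
proof (rule idealI[OF ring_coord_ring])
  show "subgroup {p \<in> polys_in (coords N). f dvd kill K p} (add_monoid (coord_ring N))"
  proof (rule group.subgroupI)
    show "group (add_monoid (coord_ring N))"
      using ring_coord_ring abelian_group.a_group ring.is_abelian_group by blast
    show "{p \<in> polys_in (coords N). f dvd kill K p} \<noteq> {}"
      by (auto simp: kill_id vars_def intro!: exI[of _ 0])
    fix p assume p: "p \<in> {p \<in> polys_in (coords N). f dvd kill K p}"
    have "kill K (- p) = - kill K p"
      using kill.ext_add[of K p "- p"] by (simp add: kill_id vars_def eq_neg_iff_add_eq_0 add.commute)
    with p have mem: "- p \<in> {p \<in> polys_in (coords N). f dvd kill K p}"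
      by (simp add: polys_in_uminus)
    have "inv\<^bsub>add_monoid (coord_ring N)\<^esub> p = - p"
      using p mem by (intro group.inv_equality[OF \<open>group (add_monoid (coord_ring N))\<close>]) (auto simp: coord_ring_def)
    with mem show "inv\<^bsub>add_monoid (coord_ring N)\<^esub> p \<in> {p \<in> polys_in (coords N). f dvd kill K p}"
      by simp
  qed (auto simp: coord_ring_def polys_in_add kill.ext_add)
qed (auto simp: coord_ring_def polys_in_mult kill.ext_mult)

text \<open>The preimage ideal contains all generators of the vanishing ideal: \<open>kill\<close>
  sends the killed coordinates to 0 and fixes f. It therefore contains p, which \<open>kill\<close>
  fixes as well.\<close>

lemma nonlinear_generator_dvd:
  assumes f: "nonlinear_generator N V f"
    and p: "p \<in> polys_in (free_coords N (tau N V))"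
    and vanish: "\<And>A. A \<in> Abstract_Topology.closure_of (zariski N) V \<Longrightarrow> peval p A = 0"
  shows "f dvd p"
proof -
  define K where "K = killed_coords N (tau N V)"
  define J where "J = {p \<in> polys_in (coords N). f dvd kill K p}"
  have free: "free_coords N (tau N V) = coords N - K"
    by (simp add: K_def free_coords_eq)
  have K: "K \<subseteq> coords N" by (auto simp: K_def killed_coords_def)
  have fin: "f \<in> polys_in (coords N - K)"
    and ideal_eq: "vanishing_ideal N (Abstract_Topology.closure_of (zariski N) V) =
       Idl\<^bsub>coord_ring N\<^esub> ({pvar s t | s t. (s, t) \<in> K} \<union> {f})"
    using f by (auto simp: nonlinear_generator_def K_def)
  have "f \<in> J"
  proof -
    have "kill K f = f"
      using fin by (intro kill_id) (auto simp: polys_in_iff_vars)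
    then show ?thesis
      using polys_in_mono[OF fin Diff_subset] by (simp add: J_def)
  qed
  moreover have "pvar s t \<in> J" if "(s, t) \<in> K" for s t
  proof -
    have "kill K (pvar s t) = 0"
      using that by (simp add: pvar_def)
    then show ?thesis using that K by (auto simp: J_def polys_in_pvar)
  qed
  ultimately have "{pvar s t | s t. (s, t) \<in> K} \<union> {f} \<subseteq> J" by auto
  then have "Idl\<^bsub>coord_ring N\<^esub> ({pvar s t | s t. (s, t) \<in> K} \<union> {f}) \<subseteq> J"
    using ideal_dvd_kill[of N f K] unfolding genideal_def J_def by blast
  moreover have "p \<in> vanishing_ideal N (Abstract_Topology.closure_of (zariski N) V)"
    using vanish polys_in_mono[OF p, of "coords N"] by (auto simp: vanishing_ideal_def free)
  ultimately have "f dvd kill K p"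
    unfolding ideal_eq J_def by blast
  moreover have "kill K p = p"
    using p by (intro kill_id) (auto simp: free polys_in_iff_vars)
  ultimately show ?thesis by simp
qed

lemma nonlinear_generator_vanishes:
  assumes "nonlinear_generator N V f" "A \<in> Abstract_Topology.closure_of (zariski N) V"
  shows "peval f A = 0"
proof -
  have "f \<in> vanishing_ideal N (Abstract_Topology.closure_of (zariski N) V)"
    using assms(1) by (auto simp: nonlinear_generator_def genideal_def)
  then show ?thesis using assms(2) by (simp add: vanishing_ideal_def)
qed

section \<open>Variables forced by the \<open>\<sigma>\<close>-set\<close>

lemma munit_mult:
  assumes "1 \<le> j" "j \<le> N"
  shows "munit N i j * munit N k l = (if j = k then munit N i l else 0\<^sub>m N N)"
proof (rule eq_matI)
  fix r s assume "r < dim_row (if j = k then munit N i l else 0\<^sub>m N N)"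
    "s < dim_col (if j = k then munit N i l else 0\<^sub>m N N)"
  then have rs: "r < N" "s < N" by (auto simp: munit_def split: if_splits)
  have "(munit N i j * munit N k l) $$ (r, s)
      = (\<Sum>c\<in>{0..<N}. if c = j - 1 then (if r + 1 = i \<and> j = k \<and> s + 1 = l then 1 else 0) else 0)"
  proof -
    have "(munit N i j * munit N k l) $$ (r, s) = (\<Sum>c\<in>{0..<N}. munit N i j $$ (r, c) * munit N k l $$ (c, s))"
      using rs by (simp add: scalar_prod_def munit_def)
    also have "\<dots> = (\<Sum>c\<in>{0..<N}. if c = j - 1 then (if r + 1 = i \<and> j = k \<and> s + 1 = l then 1 else 0) else 0)"
      using rs assms by (intro sum.cong) (auto simp: munit_def)
    finally show ?thesis .
  qed
  also have "\<dots> = (if j = k then munit N i l else 0\<^sub>m N N) $$ (r, s)"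
    using rs assms by (auto simp: munit_def)
  finally show "(munit N i j * munit N k l) $$ (r, s) = (if j = k then munit N i l else 0\<^sub>m N N) $$ (r, s)" .
qed (auto simp: munit_def)

text \<open>The bracket of the units at (i, j) and (j, j + 1) is the unit at (i, j + 1), since the
  product in the other order vanishes.\<close>

lemma munit_in_n_sub:
  assumes "1 \<le> a" "Suc b \<le> N" "a \<le> i" "Suc i \<le> j" "j \<le> Suc b"
  shows "munit N i j \<in> n_sub N {a..b}"
  using assms(4,5)
proof (induction j rule: dec_induct)
  case base
  have "munit N i (i + 1) \<in> n_sub N {a..b}"
    using assms unfolding n_sub_def by (intro lie_subalgebra.gen) auto
  then show ?case by (simp only: Suc_eq_plus1)
next
  case (step j)
  have "munit N j (j + 1) \<in> n_sub N {a..b}"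
    using assms step unfolding n_sub_def by (intro lie_subalgebra.gen) auto
  then have "munit N i j * munit N j (j + 1) - munit N j (j + 1) * munit N i j \<in> n_sub N {a..b}"
    using step unfolding n_sub_def by (intro lie_subalgebra.bracket) auto
  moreover have "munit N i j * munit N j (j + 1) - munit N j (j + 1) * munit N i j = munit N i (j + 1)"
    using step assms munit_mult[of j N i j "j + 1"] munit_mult[of "j + 1" N j i j]
    by (auto simp: munit_def)
  ultimately show ?case by (simp only: Suc_eq_plus1)
qed

lemma finite_coords: "finite (coords N)"
  by (rule finite_subset[of _ "{1..N} \<times> {1..N}"]) (auto simp: coords_def)

lemma lin_form_munit:
  assumes "(i, j) \<in> coords N"
  shows "lin_form N (munit N i j) = pvar i j"
proof -
  have "lin_form N (munit N i j) = (\<Sum>v\<in>coords N. if v = (i, j) then pvar i j else 0)"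
    unfolding lin_form_def
  proof (intro sum.cong refl)
    fix v assume "v \<in> coords N"
    then obtain r s where v: "v = (r, s)" "1 \<le> r" "r \<le> N" "1 \<le> s" "s \<le> N"
      by (auto simp: coords_def)
    then show "(case v of (r, s) \<Rightarrow> pconst (munit N i j $$ (r - 1, s - 1)) * pvar r s) = (if v = (i, j) then pvar i j else 0)"
      by (auto simp: munit_def pconst_def pvar_def mult_single)
  qed
  also have "\<dots> = pvar i j" using assms finite_coords by simp
  finally show ?thesis .
qed

lemma polys_in_sym_algebra:
  assumes "\<And>i j. (i, j) \<in> S \<Longrightarrow> pvar i j \<in> sym_algebra N W" and p: "p \<in> polys_in S"
  shows "p \<in> sym_algebra N W"
proof -
  have one: "1 \<in> sym_algebra N W"
    using sym_algebra.const[of 1 N W] by (simp add: pconst_def)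
  have zero: "0 \<in> sym_algebra N W"
    using sym_algebra.const[of 0 N W] by (simp add: pconst_def)
  have power: "Poly_Mapping.single (Poly_Mapping.single v n) 1 \<in> sym_algebra N W" if "v \<in> S" for v n
  proof (induction n)
    case (Suc n)
    have "Poly_Mapping.single (Poly_Mapping.single v (Suc n)) (1 :: complex)
        = Poly_Mapping.single (Poly_Mapping.single v n) 1 * pvar (fst v) (snd v)"
      by (simp add: pvar_def mult_single single_add[symmetric] Suc_eq_plus1)
    then show ?case using Suc assms(1)[of "fst v" "snd v"] that by (simp add: sym_algebra.mult)
  qed (use one in simp)
  have mono: "Poly_Mapping.single (\<Sum>v\<in>F. Poly_Mapping.single v (Poly_Mapping.lookup m v)) 1 \<in> sym_algebra N W"
    if "finite F" "F \<subseteq> S" for F m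
    using that
  proof (induction F)
    case (insert v F)
    have "Poly_Mapping.single (\<Sum>v\<in>insert v F. Poly_Mapping.single v (Poly_Mapping.lookup m v)) (1 :: complex)
      = Poly_Mapping.single (Poly_Mapping.single v (Poly_Mapping.lookup m v)) 1 *
        Poly_Mapping.single (\<Sum>v\<in>F. Poly_Mapping.single v (Poly_Mapping.lookup m v)) 1"
      using insert by (simp add: mult_single)
    then show ?case using insert power by (simp add: sym_algebra.mult)
  qed (use one in simp)
  have single: "Poly_Mapping.single m c \<in> sym_algebra N W" if "Poly_Mapping.keys m \<subseteq> S" for m c
  proof -
    have "Poly_Mapping.single m c = pconst c * Poly_Mapping.single m 1"
      by (simp add: pconst_def mult_single)
    then show ?thesis
      using mono[OF finite_keys that, of m] sym_algebra.const[of c N W]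
      by (simp add: poly_mapping_sum_singles sym_algebra.mult)
  qed
  have "(\<Sum>m\<in>F. Poly_Mapping.single m (Poly_Mapping.lookup p m)) \<in> sym_algebra N W"
    if "finite F" "F \<subseteq> Poly_Mapping.keys p" for F
    using that
  proof (induction F)
    case (insert m F)
    then show ?case
      using p by (auto simp: polys_in_def intro!: sym_algebra.add single)
  qed (use zero in simp)
  from this[OF finite_keys order_refl] show ?thesis
    by (simp add: poly_mapping_sum_singles)
qed

text \<open>This inclusion turns a missing row or column of variables into membership in the
  symmetric algebra of a smaller interval, which contradicts minimality of the \<sigma>-set.\<close>

lemma polys_in_sym_algebra_n_sub:
  assumes "1 \<le> a" "Suc b \<le> N" "p \<in> polys_in {(i, j). a \<le> i \<and> i < j \<and> j \<le> Suc b}"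
  shows "p \<in> sym_algebra N (n_sub N {a..b})"
proof (rule polys_in_sym_algebra[OF _ assms(3)])
  fix i j assume "(i, j) \<in> {(i, j). a \<le> i \<and> i < j \<and> j \<le> Suc b}"
  with assms have "(i, j) \<in> coords N" "munit N i j \<in> n_sub N {a..b}"
    by (auto simp: coords_def intro!: munit_in_n_sub)
  then show "pvar i j \<in> sym_algebra N (n_sub N {a..b})"
    using sym_algebra.lin lin_form_munit by metis
qed

lemma nonlinear_generator_nonzero:
  assumes "nonlinear_generator N V f"
  shows "f \<noteq> 0" "vars f \<noteq> {}" "vars f \<subseteq> coords N"
proof -
  show nz: "f \<noteq> 0"
    using assms by (auto simp: nonlinear_generator_def Factorial_Ring.irreducible_def)
  obtain d where d: "2 \<le> d" "homogeneous d f"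
    using assms by (auto simp: nonlinear_generator_def)
  from nz obtain m where m: "m \<in> Poly_Mapping.keys f"
    by (metis poly_mapping_neq_0E in_keys_iff)
  with d have "Poly_Mapping.keys m \<noteq> {}"
    by (fastforce simp: homogeneous_def)
  with m show "vars f \<noteq> {}" by (auto simp: vars_def)
  show "vars f \<subseteq> coords N"
    using assms by (auto simp: nonlinear_generator_def polys_in_iff_vars)
qed

text \<open>\<open>sigma_set\<close> supplies some generator g, possibly different from f.
  Minimality forces g to meet row 1 and column N, and g divides f, so the variables of g occur in f
  too.\<close>

lemma sigma_set_full_vars:
  assumes sig: "sigma_set N V {1..<N}" and f: "nonlinear_generator N V f"
  shows "2 \<le> N" "\<exists>j. (1, j) \<in> vars f" "\<exists>i. (i, N) \<in> vars f"
proof -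
  obtain g where g: "nonlinear_generator N V g" and con: "connected_simple N {1..<N}"
    and minimal: "\<And>\<sigma>'. connected_simple N \<sigma>' \<Longrightarrow> g \<in> sym_algebra N (n_sub N \<sigma>') \<Longrightarrow> {1..<N} \<subseteq> \<sigma>'"
    using sig by (auto simp: sigma_set_def)
  obtain a b where "1 \<le> a" "a \<le> b" "b \<le> N - 1"
    using con by (auto simp: connected_simple_def)
  then show N: "2 \<le> N" by linarith
  have vars_g: "vars g \<noteq> {}" "vars g \<subseteq> coords N"
    using nonlinear_generator_nonzero[OF g] by auto
  have "g dvd f"
  proof (rule nonlinear_generator_dvd[OF g])
    show "f \<in> polys_in (free_coords N (tau N V))"
      using f by (simp add: nonlinear_generator_def free_coords_eq)
  qed (rule nonlinear_generator_vanishes[OF f])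
  then have sub: "vars g \<subseteq> vars f"
    using nonlinear_generator_nonzero(1)[OF f] by (rule vars_dvd)
  have not_sym: "\<not> g \<in> polys_in {(i, j). a \<le> i \<and> i < j \<and> j \<le> Suc b}"
    if "1 \<le> a" "Suc b \<le> N" "1 < a \<or> Suc b < N" for a b
  proof
    assume *: "g \<in> polys_in {(i, j). a \<le> i \<and> i < j \<and> j \<le> Suc b}"
    \<comment> \<open>A connected set is nonempty by definition. That the degree is at least 2
      provides a variable of g, which rules out an empty interval, in particular when N = 2.\<close>
    then have "a \<le> b" using vars_g(1) by (force simp: polys_in_iff_vars)
    then have "connected_simple N {a..b}"
      using that by (auto simp: connected_simple_def)
    then have "{1..<N} \<subseteq> {a..b}"
      using polys_in_sym_algebra_n_sub[OF that(1,2) *] by (rule minimal)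
    moreover have "1 \<in> {1..<N}" "N - 1 \<in> {1..<N}"
      using N by auto
    ultimately have "1 \<in> {a..b}" "N - 1 \<in> {a..b}"
      by blast+
    then show False using that by auto
  qed
  have "\<exists>j. (1, j) \<in> vars g"
  proof (rule ccontr)
    assume no: "\<not> (\<exists>j. (1, j) \<in> vars g)"
    have "vars g \<subseteq> {(i, j). 2 \<le> i \<and> i < j \<and> j \<le> Suc (N - 1)}"
    proof
      fix v assume "v \<in> vars g"
      moreover obtain i j where v: "v = (i, j)" by (cases v)
      ultimately have "i \<noteq> 1" "1 \<le> i" "i < j" "j \<le> N" using no vars_g(2) by (auto simp: coords_def)
      then show "v \<in> {(i, j). 2 \<le> i \<and> i < j \<and> j \<le> Suc (N - 1)}" using v by auto
    qed
    then show False using not_sym[of 2 "N - 1"] N by (simp add: polys_in_iff_vars)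
  qed
  then show "\<exists>j. (1, j) \<in> vars f" using sub by blast
  have "\<exists>i. (i, N) \<in> vars g"
  proof (rule ccontr)
    assume no: "\<not> (\<exists>i. (i, N) \<in> vars g)"
    have "vars g \<subseteq> {(i, j). 1 \<le> i \<and> i < j \<and> j \<le> Suc (N - 2)}"
    proof
      fix v assume "v \<in> vars g"
      moreover obtain i j where v: "v = (i, j)" by (cases v)
      ultimately have "j \<noteq> N" "1 \<le> i" "i < j" "j \<le> N" using no vars_g(2) by (auto simp: coords_def)
      then show "v \<in> {(i, j). 1 \<le> i \<and> i < j \<and> j \<le> Suc (N - 2)}" using v by auto
    qed
    moreover have "Suc (N - 2) < N" using N by arith
    ultimately show False using not_sym[of 1 "N - 2"] by (simp add: polys_in_iff_vars)
  qed
  then show "\<exists>i. (i, N) \<in> vars f" using sub by blast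
qed

section \<open>The minor as a matrix power\<close>

lemma generic_matrix_pow_eq_0: "generic_matrix N \<tau> ^\<^sub>m N = 0\<^sub>m N N"
proof (rule eq_matI)
  fix i j assume "i < dim_row (0\<^sub>m N N)" "j < dim_col (0\<^sub>m N N)"
  then have ij: "i < N" "j < N" by simp_all
  have "lev \<tau> (Suc j) < lev \<tau> (Suc i) + N"
    using lev_less[of "Suc j" \<tau>] ij by linarith
  then have "walk_poly N \<tau> N (Suc i) (Suc j) = 0"
    using ij by (intro walk_poly_eq_0) auto
  then show "(generic_matrix N \<tau> ^\<^sub>m N) $$ (i, j) = 0\<^sub>m N N $$ (i, j)"
    using ij by (simp add: walk_poly_def)
qed (auto simp: carrier_matD[OF generic_matrix_carrier])

text \<open>The Neumann series for \<open>(x + t)\<^sup>-\<^sup>1\<close>, multiplied by \<open>t\<^sup>N\<close>, gives the adjugate of \<open>x + t\<close>.\<close>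

lemma minor_coeff_eq:
  assumes N: "1 \<le> N" and j: "j < N"
  shows "minor_coeff N \<tau> 1 j = (- 1) ^ (N - 1) * (- 1) ^ j * walk_poly N \<tau> j 1 N"
proof -
  define X where "X = generic_matrix N \<tau>"
  define Y where "Y = map_mat (\<lambda>p. [:p:]) X + [:0, 1:] \<cdot>\<^sub>m 1\<^sub>m N"
  define B where "B = mat N N (\<lambda>(i, l). \<Sum>k<N. monom ((- 1) ^ k * (X ^\<^sub>m k) $$ (i, l)) (N - 1 - k))"
  define t where "t = monom (1 :: cpoly) N"
  have X: "X \<in> carrier_mat N N" and Y: "Y \<in> carrier_mat N N" and B: "B \<in> carrier_mat N N"
    by (simp_all add: X_def Y_def B_def)
  have Xpow: "X ^\<^sub>m k \<in> carrier_mat N N" for k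
    using X by (rule pow_carrier_mat)
  have Y_entry: "Y $$ (i, l) = [:X $$ (i, l):] + (if i = l then [:0, 1:] else 0)" if "i < N" "l < N" for i l
    using that X by (simp add: Y_def)
  have B_entry: "B $$ (i, l) = (\<Sum>k<N. monom ((- 1) ^ k * (X ^\<^sub>m k) $$ (i, l)) (N - 1 - k))"
    if "i < N" "l < N" for i l
    using that by (simp add: B_def)
  have X_low: "X $$ (i, l) = 0" if "i < N" "l \<le> i" for i l
    using that generic_matrix_entry[of "Suc i" N "Suc l" \<tau>] lev_mono[of "Suc l" "Suc i" \<tau>]
    by (simp add: X_def)
  have BY: "B * Y = t \<cdot>\<^sub>m 1\<^sub>m N"
  proof (rule eq_matI)
    fix i l assume "i < dim_row (t \<cdot>\<^sub>m 1\<^sub>m N)" "l < dim_col (t \<cdot>\<^sub>m 1\<^sub>m N)"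
    then have il: "i < N" "l < N" by simp_all
    \<comment> \<open>Multiplying the k-th term of B by the indeterminate gives \<open>u k\<close>,
      multiplying it by X gives \<open>- u (Suc k)\<close>. The sum telescopes to
      \<open>u 0 - u N\<close>, and \<open>u N = 0\<close> since the N-th power of X
      vanishes.\<close>
    define u where "u k = monom ((- 1) ^ k * (X ^\<^sub>m k) $$ (i, l)) (N - k)" for k
    have "(B * Y) $$ (i, l) = (\<Sum>c\<in>{0..<N}. B $$ (i, c) * Y $$ (c, l))"
      using il B Y by (simp add: scalar_prod_def)
    also have "\<dots> = (\<Sum>c\<in>{0..<N}. B $$ (i, c) * [:X $$ (c, l):]) + (\<Sum>c\<in>{0..<N}. if c = l then B $$ (i, c) * [:0, 1:] else 0)"
      unfolding sum.distrib[symmetric] using il by (intro sum.cong) (auto simp: Y_entry algebra_simps)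
    also have "(\<Sum>c\<in>{0..<N}. if c = l then B $$ (i, c) * [:0, 1:] else 0) = B $$ (i, l) * [:0, 1:]"
      using il by simp
    also have "B $$ (i, l) * [:0, 1:] = (\<Sum>k<N. u k)"
    proof -
      have "monom a (N - 1 - k) * [:0, 1:] = monom a (N - k)" if "k < N" for a :: cpoly and k
      proof -
        have "N - k = Suc (N - 1 - k)" using that by simp
        then show ?thesis by (simp add: monom_Suc)
      qed
      then show ?thesis
        unfolding B_entry[OF il] sum_distrib_right u_def by (intro sum.cong refl) simp
    qed
    also have "(\<Sum>c\<in>{0..<N}. B $$ (i, c) * [:X $$ (c, l):]) = (\<Sum>k<N. - u (Suc k))"
    proof -
      have "(\<Sum>c\<in>{0..<N}. B $$ (i, c) * [:X $$ (c, l):])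
          = (\<Sum>c\<in>{0..<N}. \<Sum>k<N. monom ((- 1) ^ k * ((X ^\<^sub>m k) $$ (i, c) * X $$ (c, l))) (N - 1 - k))"
        using il by (intro sum.cong refl)
          (simp add: B_entry sum_distrib_right mult.assoc mult_monom flip: monom_0)
      also have "\<dots> = (\<Sum>k<N. \<Sum>c\<in>{0..<N}. monom ((- 1) ^ k * ((X ^\<^sub>m k) $$ (i, c) * X $$ (c, l))) (N - 1 - k))"
        by (rule sum.swap)
      also have "\<dots> = (\<Sum>k<N. monom ((- 1) ^ k * (\<Sum>c\<in>{0..<N}. (X ^\<^sub>m k) $$ (i, c) * X $$ (c, l))) (N - 1 - k))"
        by (simp add: monom_sum sum_distrib_left)
      also have "\<dots> = (\<Sum>k<N. - u (Suc k))"
      proof (intro sum.cong refl)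
        fix k assume "k \<in> {..<N}"
        have "(\<Sum>c\<in>{0..<N}. (X ^\<^sub>m k) $$ (i, c) * X $$ (c, l)) = (X ^\<^sub>m Suc k) $$ (i, l)"
          using il X Xpow[of k] by (simp add: scalar_prod_def)
        moreover have "N - 1 - k = N - Suc k" by arith
        ultimately show "monom ((- 1) ^ k * (\<Sum>c\<in>{0..<N}. (X ^\<^sub>m k) $$ (i, c) * X $$ (c, l))) (N - 1 - k) = - u (Suc k)"
          by (simp only: u_def minus_monom power_Suc mult_minus1 mult_minus_left minus_minus mult_1_left)
      qed
      finally show ?thesis .
    qed
    also have "(\<Sum>k<N. - u (Suc k)) + (\<Sum>k<N. u k) = u 0 - u N"
      by (simp add: sum_negf sum_subtractf[symmetric] sum_lessThan_telescope')
    also have "\<dots> = (t \<cdot>\<^sub>m 1\<^sub>m N) $$ (i, l)"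
      using il generic_matrix_pow_eq_0[of N \<tau>] X by (simp add: u_def t_def X_def carrier_matD[OF generic_matrix_carrier])
    finally show "(B * Y) $$ (i, l) = (t \<cdot>\<^sub>m 1\<^sub>m N) $$ (i, l)" .
  qed (use B Y in auto)
  have "det Y = t"
  proof -
    have "upper_triangular Y"
      using Y by (auto simp: upper_triangular_def Y_entry X_low)
    then have "det Y = prod_list (diag_mat Y)"
      using Y by (rule det_upper_triangular)
    also have "diag_mat Y = replicate N [:0, 1:]"
      using Y by (intro nth_equalityI) (auto simp: diag_mat_def Y_entry X_low)
    finally show ?thesis by (simp add: t_def monom_altdef)
  qed
  then have YA: "Y * adj_mat Y = t \<cdot>\<^sub>m 1\<^sub>m N"
    using adj_mat(2)[OF Y] by simp
  have A: "adj_mat Y \<in> carrier_mat N N"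
    using adj_mat(1)[OF Y] .
  \<comment> \<open>The product \<open>B * Y * adj_mat Y\<close> is computed in two ways. Here
    \<open>t\<close> is the N-th power of the indeterminate; being nonzero, it cancels
    entrywise.\<close>
  have "t \<cdot>\<^sub>m adj_mat Y = (t \<cdot>\<^sub>m 1\<^sub>m N) * adj_mat Y"
    using A by (subst mult_smult_assoc_mat[of _ N N _ N]) auto
  also have "\<dots> = B * (t \<cdot>\<^sub>m 1\<^sub>m N)"
    unfolding BY[symmetric] using assoc_mult_mat[OF B Y A] unfolding YA BY .
  also have "\<dots> = t \<cdot>\<^sub>m B"
    using B by (subst mult_smult_distrib[of _ N N _ N]) auto
  finally have eq: "t \<cdot>\<^sub>m adj_mat Y = t \<cdot>\<^sub>m B" .
  have "t * adj_mat Y $$ (0, N - 1) = t * B $$ (0, N - 1)"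
    using arg_cong[OF eq, of "\<lambda>M. M $$ (0, N - 1)"] A B N by simp
  then have adj: "adj_mat Y $$ (0, N - 1) = B $$ (0, N - 1)"
    by (simp add: t_def)
  \<comment> \<open>The corner of size N - 1 arises by deleting the last row and the first column.
    The adjugate transposes, so the matching cofactor is its entry (0, N - 1).\<close>
  have "cMin N 1 Y = mat_delete Y (N - 1) 0"
    using Y by (intro eq_matI) (auto simp: cMin_def mat_delete_def Suc_eq_plus1)
  then have "char_minor N \<tau> 1 = det (mat_delete Y (N - 1) 0)"
    by (simp add: char_minor_def Y_def X_def)
  \<comment> \<open>The cofactor contains the same sign, so the two signs multiply to 1.\<close>
  also have "\<dots> = (- 1) ^ (N - 1) * cofactor Y (N - 1) 0"
    by (simp add: cofactor_def mult.assoc[symmetric] flip: power_add mult_2)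
  also have "cofactor Y (N - 1) 0 = B $$ (0, N - 1)"
    using adj Y N by (simp add: adj_mat_def)
  finally have cm: "char_minor N \<tau> 1 = (- 1) ^ (N - 1) * B $$ (0, N - 1)" .
  \<comment> \<open>The exponents N - 1 - k are distinct for k < N, so only k = j
    contributes.\<close>
  have "coeff (B $$ (0, N - 1)) (N - 1 - j) = (\<Sum>k<N. if k = j then (- 1) ^ k * (X ^\<^sub>m k) $$ (0, N - 1) else 0)"
  proof -
    have "N - 1 - k = N - 1 - j \<longleftrightarrow> k = j" if "k < N" for k
      using that j by arith
    then show ?thesis
      using N by (subst B_entry) (auto simp only: coeff_sum coeff_monom lessThan_iff intro!: sum.cong)
  qed
  also have "\<dots> = (- 1) ^ j * walk_poly N \<tau> j 1 N"
    using j by (simp add: walk_poly_def X_def)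
  finally have "coeff (B $$ (0, N - 1)) (N - 1 - j) = (- 1) ^ j * walk_poly N \<tau> j 1 N" .
  moreover have "coeff ((- 1) ^ n * q) m = (- 1) ^ n * coeff q m" for n m and q :: "cpoly poly"
    by (cases "even n") simp_all
  ultimately show ?thesis
    by (simp add: minor_coeff_def cm mult.assoc)
qed

section \<open>Irreducibility of the walk polynomial\<close>

lemma vars_walk_polyD:
  assumes "v \<in> vars (walk_poly k \<tau> n a b)" "1 \<le> a" "a \<le> k" "1 \<le> b" "b \<le> k"
  obtains p t where "walk k \<tau> n a b p" "t < n" "v = (p t, p (Suc t))"
proof -
  obtain m where m: "m \<in> Poly_Mapping.keys (walk_poly k \<tau> n a b)" "v \<in> Poly_Mapping.keys m"
    using assms(1) by (auto simp: vars_def)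
  obtain p where "walk k \<tau> n a b p" "m = walk_mono p n"
    using keys_walk_poly[OF m(1) assms(2-)] by blast
  then show ?thesis using that m(2) by (auto simp: keys_walk_mono)
qed

lemma walk_poly_add:
  assumes "1 \<le> a" "a \<le> k" "1 \<le> b" "b \<le> k"
  shows "walk_poly k \<tau> (m + n) a b = (\<Sum>c\<in>{1..k}. walk_poly k \<tau> m a c * walk_poly k \<tau> n c b)"
  using assms(3,4)
proof (induction n arbitrary: b)
  case 0
  have "(\<Sum>c\<in>{1..k}. walk_poly k \<tau> m a c * walk_poly k \<tau> 0 c b)
      = (\<Sum>c\<in>{1..k}. if c = b then walk_poly k \<tau> m a c else 0)"
    using 0 by (intro sum.cong) (auto simp: walk_poly_0)
  then show ?case using 0 by simp
next
  case (Suc n)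
  define E where "E d = (if lev \<tau> d < lev \<tau> b then pvar d b else 0)" for d
  have "walk_poly k \<tau> (m + Suc n) a b = (\<Sum>d\<in>{1..k}. walk_poly k \<tau> (m + n) a d * E d)"
    using walk_poly_Suc[OF assms(1,2) Suc.prems, of \<tau> "m + n"] by (simp add: E_def)
  also have "\<dots> = (\<Sum>d\<in>{1..k}. \<Sum>c\<in>{1..k}. walk_poly k \<tau> m a c * (walk_poly k \<tau> n c d * E d))"
    using Suc.IH by (intro sum.cong refl) (simp add: sum_distrib_right mult.assoc)
  also have "\<dots> = (\<Sum>c\<in>{1..k}. \<Sum>d\<in>{1..k}. walk_poly k \<tau> m a c * (walk_poly k \<tau> n c d * E d))"
    by (rule sum.swap)
  also have "\<dots> = (\<Sum>c\<in>{1..k}. walk_poly k \<tau> m a c * walk_poly k \<tau> (Suc n) c b)"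
    using Suc.prems by (intro sum.cong refl) (simp add: walk_poly_Suc E_def sum_distrib_left)
  finally show ?case .
qed

lemma walk_poly_nonzero:
  assumes "walk k \<tau> n a b p"
  shows "walk_poly k \<tau> n a b \<noteq> 0"
  using peval_walk_poly_walk_matrix[OF assms order_refl] by auto

lemma mono_eval_nonzero:
  assumes "mono_eval A m \<noteq> 0" "(i, j) \<in> Poly_Mapping.keys m"
  shows "A $$ (i - 1, j - 1) \<noteq> 0"
proof
  assume "A $$ (i - 1, j - 1) = 0"
  then have "mono_eval A m = 0"
    unfolding mono_eval_def using assms(2)
    by (intro prod_zero bexI[of _ "(i, j)"]) (auto simp: in_keys_iff)
  with assms(1) show False by simp
qed

text \<open>A polynomial with a nonzero value has a monomial with a nonzero value, and at the matrix
  of p such a monomial can only contain edges of p.\<close>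

lemma keys_walk_poly_walk_matrix:
  assumes w: "walk k \<tau> n a b p"
  obtains m where "m \<in> Poly_Mapping.keys (walk_poly k \<tau> n a b)"
    "Poly_Mapping.keys m \<subseteq> {(p t, p (Suc t)) | t. t < n}"
proof -
  have ab: "1 \<le> a" "a \<le> k" "1 \<le> b" "b \<le> k"
    using w by (auto simp: walk_def)
  have "peval (walk_poly k \<tau> n a b) (walk_matrix k p n) \<noteq> 0"
    using peval_walk_poly_walk_matrix[OF w order_refl] by simp
  then obtain m where m: "m \<in> Poly_Mapping.keys (walk_poly k \<tau> n a b)" "mono_eval (walk_matrix k p n) m \<noteq> 0"
    unfolding peval.ext_def by (metis (no_types, lifting) mult_zero_right sum.neutral)
  obtain q where q: "walk k \<tau> n a b q" "m = walk_mono q n"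
    using keys_walk_poly[OF m(1) ab] by blast
  have "v \<in> {(p t, p (Suc t)) | t. t < n}" if v: "v \<in> Poly_Mapping.keys m" for v
  proof -
    obtain s where s: "s < n" "v = (q s, q (Suc s))"
      using v q(2) by (auto simp: keys_walk_mono)
    have "walk_matrix k p n $$ (q s - 1, q (Suc s) - 1) \<noteq> 0"
      using mono_eval_nonzero[OF m(2)] v s by blast
    moreover have "1 \<le> q s" "q s \<le> k" "1 \<le> q (Suc s)" "q (Suc s) \<le> k"
      using q(1) s by (auto simp: walk_def)
    ultimately show ?thesis
      using s by (auto simp: walk_matrix_entry split: if_splits)
  qed
  then show ?thesis using that[OF m(1)] by blast
qed

text \<open>
  Two distinct variables that occur in no common monomial of \<open>g\<close> lie in the same factor of \<open>g = f h\<close>.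
  As the inner chains have at least two elements, this puts all variables into \<open>f\<close>.
\<close>

lemma walk_poly_eq_generator:
  fixes f :: cpoly
  assumes N: "1 \<le> N" and L_def: "L = lev \<tau> N"
    and dvd: "\<And>a b. 1 \<le> a \<Longrightarrow> a \<le> N \<Longrightarrow> 1 \<le> b \<Longrightarrow> b \<le> N \<Longrightarrow> f dvd walk_poly N \<tau> L a b"
    and prime: "\<And>p q. p \<in> polys_in (free_coords N \<tau>) \<Longrightarrow> q \<in> polys_in (free_coords N \<tau>) \<Longrightarrow>
      p * q = walk_poly N \<tau> L 1 N \<Longrightarrow> f dvd p \<or> f dvd q"
    and first: "(1, j) \<in> vars f" and last: "(i, N) \<in> vars f"
  shows "\<exists>c. c \<noteq> 0 \<and> walk_poly N \<tau> L 1 N = pconst c * f"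
proof -
  have le_L: "lev \<tau> x \<le> L" if "x \<le> N" for x
    using lev_mono[OF that] by (simp add: L_def)
  have range: "1 \<le> p t \<and> p t \<le> N" if "walk N \<tau> n a b p" "t \<le> n" for n a b p t
    using that by (auto simp: walk_def)
  \<comment> \<open>f divides a nonzero entry in row x, so its variable (1, j) is an edge of a walk
    that starts at x. As 1 has level 0, this edge is the first step, and x = 1.\<close>
  have first_level: "x = 1" if x: "1 \<le> x" "x \<le> N" "lev \<tau> x = 0" for x
  proof (rule level_walk[of N L \<tau> x x])
    fix p assume p: "walk N \<tau> L (p 0) (p L) p" "p (lev \<tau> x) = x"
    then have "p 0 = x" using x by simp
    with p have w: "walk N \<tau> L x (p L) p" by simp
    have b: "1 \<le> p L" "p L \<le> N" using range[OF w] by auto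
    have "vars f \<subseteq> vars (walk_poly N \<tau> L x (p L))"
      using dvd[OF x(1,2) b] walk_poly_nonzero[OF w] by (rule vars_dvd)
    then obtain q t where q: "walk N \<tau> L x (p L) q" "t < L" "(1, j) = (q t, q (Suc t))"
      using first vars_walk_polyD[OF _ x(1,2) b] by blast
    have "lev \<tau> (q t) = lev \<tau> x + t"
      using q(2) le_L[OF b(2)] by (intro walk_lev_eq[OF q(1)]) auto
    then have "t = 0" using q(3)[symmetric] x by simp
    then show "x = 1" using q by (simp add: walk_def)
  qed (use x N le_L in \<open>auto simp: L_def\<close>)
  \<comment> \<open>Dually, the variable (i, N) of f must be the last step of a walk that ends at
    x.\<close>
  have last_level: "x = N" if x: "1 \<le> x" "x \<le> N" "lev \<tau> x = L" for x
  proof (rule level_walk[of N L \<tau> x x])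
    fix p assume p: "walk N \<tau> L (p 0) (p L) p" "p (lev \<tau> x) = x" and lev_p: "\<And>t. t \<le> L \<Longrightarrow> lev \<tau> (p t) = t"
    then have "p L = x" using x by simp
    with p have w: "walk N \<tau> L (p 0) x p" by simp
    have a: "1 \<le> p 0" "p 0 \<le> N" using range[OF w] by auto
    have "vars f \<subseteq> vars (walk_poly N \<tau> L (p 0) x)"
      using dvd[OF a x(1,2)] walk_poly_nonzero[OF w] by (rule vars_dvd)
    then obtain q t where q: "walk N \<tau> L (p 0) x q" "t < L" "(i, N) = (q t, q (Suc t))"
      using last vars_walk_polyD[OF _ a x(1,2)] by blast
    have "lev \<tau> (q (Suc t)) = lev \<tau> (p 0) + Suc t"
      using q(2) le_L[OF x(2)] by (intro walk_lev_eq[OF q(1)]) auto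
    then have "Suc t = L" using q(3) lev_p[of 0] by (simp add: L_def)
    then show "x = N" using q by (simp add: walk_def)
  qed (use x N le_L in \<open>auto simp: L_def\<close>)
  define g where "g = walk_poly N \<tau> L 1 N"
  \<comment> \<open>The outer levels are now known to be {1} and {N}, so a walk through all levels
    automatically runs from 1 to N.\<close>
  have level_walk_1_N: "\<exists>p. walk N \<tau> L 1 N p \<and> (\<forall>t\<le>L. lev \<tau> (p t) = t) \<and> p (lev \<tau> x) = x \<and> p (lev \<tau> y) = y"
    if xy: "1 \<le> x" "x \<le> N" "1 \<le> y" "y \<le> N" "lev \<tau> x = lev \<tau> y \<Longrightarrow> x = y" for x y
  proof (rule level_walk[of N L \<tau> x y])
    fix p assume p: "walk N \<tau> L (p 0) (p L) p" "p (lev \<tau> x) = x" "p (lev \<tau> y) = y"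
      and lev_p: "\<And>t. t \<le> L \<Longrightarrow> lev \<tau> (p t) = t"
    have "p 0 = 1" "p L = N"
      using first_level[of "p 0"] last_level[of "p L"] lev_p range[OF p(1)] by auto
    with p lev_p show "\<exists>p. walk N \<tau> L 1 N p \<and> (\<forall>t\<le>L. lev \<tau> (p t) = t) \<and> p (lev \<tau> x) = x \<and> p (lev \<tau> y) = y"
      by (intro exI[of _ p]) auto
  qed (use xy N le_L in \<open>auto simp: L_def\<close>)
  have g_nz: "g \<noteq> 0"
    using level_walk_1_N[of 1 1] N walk_poly_nonzero unfolding g_def by blast
  have lev_g: "lev \<tau> (p t) = t" if "walk N \<tau> L 1 N p" "t \<le> L" for p t
    using walk_lev_eq[OF that(1) _ that(2)] by (simp add: L_def)
  \<comment> \<open>A monomial of g supported on the edges of p contains an edge out of each level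
    below L, and out of the level of x the walk p offers only (x, y).\<close>
  have edge: "(x, y) \<in> vars g" if xy: "1 \<le> x" "x \<le> N" "1 \<le> y" "y \<le> N" "lev \<tau> y = Suc (lev \<tau> x)" for x y
  proof -
    obtain p where p: "walk N \<tau> L 1 N p" "p (lev \<tau> x) = x" "p (lev \<tau> y) = y"
      using level_walk_1_N[of x y] xy by auto
    obtain m where m: "m \<in> Poly_Mapping.keys g" "Poly_Mapping.keys m \<subseteq> {(p t, p (Suc t)) | t. t < L}"
      using keys_walk_poly_walk_matrix[OF p(1)] unfolding g_def by blast
    obtain q where q: "walk N \<tau> L 1 N q" "m = walk_mono q L"
      using keys_walk_poly[of m N \<tau> L 1 N] m(1) N unfolding g_def by auto
    define s where "s = lev \<tau> x"
    have s: "s < L" using le_L[OF xy(4)] xy(5) by (simp add: s_def)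
    then have mem: "(q s, q (Suc s)) \<in> Poly_Mapping.keys m"
      using q(2) by (auto simp: keys_walk_mono)
    then obtain t where t: "t < L" "q s = p t" "q (Suc s) = p (Suc t)"
      using m(2) by blast
    then have "t = s"
      using lev_g[OF q(1), of s] lev_g[OF p(1), of t] s by simp
    then have "(q s, q (Suc s)) = (x, y)"
      using t p xy(5) by (simp add: s_def)
    with mem m(1) show ?thesis by (auto simp: vars_def)
  qed
  \<comment> \<open>Otherwise every walk from 1 to N of length L passes through x, and cutting the
    walks there factors g.\<close>
  have inner_level: "\<exists>y. y \<noteq> x \<and> 1 \<le> y \<and> y \<le> N \<and> lev \<tau> y = lev \<tau> x"
    if x: "1 \<le> x" "x \<le> N" "0 < lev \<tau> x" "lev \<tau> x < L" for x
  proof (rule ccontr)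
    assume "\<not> (\<exists>y. y \<noteq> x \<and> 1 \<le> y \<and> y \<le> N \<and> lev \<tau> y = lev \<tau> x)"
    then have uniq: "y = x" if "1 \<le> y" "y \<le> N" "lev \<tau> y = lev \<tau> x" for y
      using that by blast
    define s where "s = lev \<tau> x"
    define p where "p = walk_poly N \<tau> s 1 x"
    define q where "q = walk_poly N \<tau> (L - s) x N"
    \<comment> \<open>A vertex below level s cannot be reached from 1 by a walk of s steps, and
      above level s too few levels remain for the other L - s steps.\<close>
    have zero: "walk_poly N \<tau> s 1 c * walk_poly N \<tau> (L - s) c N = 0" if c: "1 \<le> c" "c \<le> N" "c \<noteq> x" for c
    proof (cases "lev \<tau> c < s")
      case True
      then have "walk_poly N \<tau> s 1 c = 0"
        using c N by (intro walk_poly_eq_0) auto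
      then show ?thesis by simp
    next
      case False
      moreover have "lev \<tau> c \<noteq> s"
        using uniq[OF c(1,2)] c(3) by (auto simp: s_def)
      ultimately have "s < lev \<tau> c" by linarith
      then have "walk_poly N \<tau> (L - s) c N = 0"
        using c N by (intro walk_poly_eq_0) (auto simp: L_def)
      then show ?thesis by simp
    qed
    have "g = walk_poly N \<tau> (s + (L - s)) 1 N"
      using x by (simp add: g_def s_def)
    also have "\<dots> = (\<Sum>c\<in>{1..N}. if c = x then p * q else 0)"
      unfolding walk_poly_add[OF order_refl N N order_refl]
      using zero by (intro sum.cong) (auto simp: p_def q_def)
    also have "\<dots> = p * q" using x by simp
    finally have pq: "g = p * q" .
    have "p \<in> polys_in (free_coords N \<tau>)" "q \<in> polys_in (free_coords N \<tau>)"
      unfolding p_def q_def using x N by (auto intro!: walk_poly_polys_in)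
    from prime[OF this] pq consider "f dvd p" | "f dvd q" by (auto simp: g_def)
    then show False
    proof cases
      case 1
      then have "(i, N) \<in> vars p"
        using vars_dvd[of f p] last pq g_nz by auto
      then obtain r t where r: "walk N \<tau> s 1 x r" "t < s" "(i, N) = (r t, r (Suc t))"
        using vars_walk_polyD[of "(i, N)" N \<tau> s 1 x] x N unfolding p_def by auto
      have "lev \<tau> (r (Suc t)) = lev \<tau> 1 + Suc t"
        using r(2) by (intro walk_lev_eq[OF r(1)]) (auto simp: s_def)
      then show False using r(2,3) x by (simp add: s_def L_def)
    next
      case 2
      then have "(1, j) \<in> vars q"
        using vars_dvd[of f q] first pq g_nz by auto
      then obtain r t where r: "walk N \<tau> (L - s) x N r" "t < L - s" "(1, j) = (r t, r (Suc t))"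
        using vars_walk_polyD[of "(1, j)" N \<tau> "L - s" x N] x N unfolding q_def by auto
      have "lev \<tau> (r t) = lev \<tau> x + t"
        using r(2) x by (intro walk_lev_eq[OF r(1)]) (auto simp: s_def L_def)
      then show False using r(3)[symmetric] x by simp
    qed
  qed
  obtain h where h: "g = f * h"
    using dvd[OF order_refl N N order_refl] unfolding g_def by (rule dvdE)
  have vars_h: "vars h \<subseteq> vars g"
    using g_nz h by (intro vars_dvd) auto
  \<comment> \<open>The monomials of g are squarefree, so total exponent 2 means that v and w are
    different edges of one walk.\<close>
  have common: "\<exists>p s t. walk N \<tau> L 1 N p \<and> s < L \<and> t < L \<and> v = (p s, p (Suc s)) \<and> w = (p t, p (Suc t)) \<and> v \<noteq> w"
    if vw: "v \<in> vars f" "w \<in> vars h" for v w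
  proof -
    obtain m where m: "m \<in> Poly_Mapping.keys g"
      "v \<noteq> w \<Longrightarrow> 2 \<le> Poly_Mapping.lookup m v + Poly_Mapping.lookup m w" "v = w \<Longrightarrow> 2 \<le> Poly_Mapping.lookup m v"
      using vars_mult_common_monomial[OF vw] unfolding h by blast
    obtain p where p: "walk N \<tau> L 1 N p" "m = walk_mono p L"
      using keys_walk_poly[of m N \<tau> L 1 N] m(1) N unfolding g_def by auto
    have le: "Poly_Mapping.lookup m v \<le> 1" "Poly_Mapping.lookup m w \<le> 1"
      using lookup_walk_mono_le_1[OF p(1)] p(2) by auto
    then have "v \<noteq> w" using m(3) by auto
    with m(2) le have "v \<in> Poly_Mapping.keys m" "w \<in> Poly_Mapping.keys m"
      by (auto simp: in_keys_iff)
    then show ?thesis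
      using p \<open>v \<noteq> w\<close> unfolding p(2) keys_walk_mono by blast
  qed
  \<comment> \<open>Induction on the level from which an edge leaves. In the base case, an edge of h
    out of level 0 would share a walk with the different edge (1, j) of f, although a walk leaves
    level 0 only once.\<close>
  have no_level: "(x, y) \<notin> vars h" if "lev \<tau> x = s" for x y s
    using that
  proof (induction s arbitrary: x y)
    case 0
    show ?case
    proof
      assume "(x, y) \<in> vars h"
      from common[OF first this] obtain p s t where p: "walk N \<tau> L 1 N p" "s < L" "t < L"
        "(1, j) = (p s, p (Suc s))" "(x, y) = (p t, p (Suc t))" "(1, j) \<noteq> (x, y)" by blast
      then have "s = 0" "t = 0"
        using lev_g[OF p(1), of s] lev_g[OF p(1), of t] 0 by auto
      then show False using p by simp
    qed
  next
    case (Suc s)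
    show ?case
    proof
      assume xy: "(x, y) \<in> vars h"
      then have "(x, y) \<in> vars g" using vars_h by blast
      then obtain p t where p: "walk N \<tau> L 1 N p" "t < L" "(x, y) = (p t, p (Suc t))"
        using vars_walk_polyD[of "(x, y)" N \<tau> L 1 N] N unfolding g_def by auto
      then have t: "t = Suc s" "1 \<le> x" "x \<le> N"
        using lev_g[OF p(1), of t] range[OF p(1), of t] Suc.prems by auto
      \<comment> \<open>The edge (z, x') enters the level of x at another vertex, so no walk
        contains it together with an edge leaving x. By induction it is not in h, hence it is in
        f.\<close>
      obtain x' where x': "x' \<noteq> x" "1 \<le> x'" "x' \<le> N" "lev \<tau> x' = Suc s"
        using inner_level[of x] t p(2) Suc.prems by auto
      obtain z where z: "1 \<le> z" "z \<le> N" "lev \<tau> z = s"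
        using lev_surj[OF N, of s \<tau>] t(1) p(2) by (auto simp: L_def)
      have "(z, x') \<in> vars f"
        using edge[of z x'] z x' Suc.IH[OF z(3)] vars_mult_subset[of f h] h by auto
      from common[OF this xy] obtain q s' t' where q: "walk N \<tau> L 1 N q" "s' < L" "t' < L"
        "(z, x') = (q s', q (Suc s'))" "(x, y) = (q t', q (Suc t'))" by blast
      then have "Suc s' = Suc s" "t' = Suc s"
        using lev_g[OF q(1), of "Suc s'"] lev_g[OF q(1), of t'] x' Suc.prems by auto
      then show False using q x'(1) by simp
    qed
  qed
  then have "vars h = {}" by auto
  then obtain c where c: "h = pconst c" by (rule vars_empty_imp_pconst)
  then have "c \<noteq> 0" using g_nz h by (auto simp: pconst_def)
  then show ?thesis using h c by (auto simp: g_def mult.commute)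
qed

text \<open>The killed coordinates are among the generators of the vanishing ideal, so they are zero
  on V.\<close>

lemma nonlinear_generator_richardson:
  assumes f: "nonlinear_generator N V f" and V: "V \<subseteq> strict_upper N"
  shows "V \<subseteq> richardson_space N (tau N V)"
proof
  fix A assume A: "A \<in> V"
  then have cl: "A \<in> Abstract_Topology.closure_of (zariski N) V"
    using closure_of_subset[of V "zariski N"] V by auto
  have "A $$ (s - 1, t - 1) = 0" if "(s, t) \<in> killed_coords N (tau N V)" for s t
  proof -
    have "pvar s t \<in> vanishing_ideal N (Abstract_Topology.closure_of (zariski N) V)"
      using f that by (auto simp: nonlinear_generator_def genideal_def)
    then show ?thesis
      using cl by (auto simp: vanishing_ideal_def peval_pvar)
  qed
  then show "A \<in> richardson_space N (tau N V)"
    using A V by (auto simp: richardson_space_def killed_coords_def coords_def)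
qed

theorem proposition1:
  fixes N I :: nat and V VR :: "complex mat set" and T TR :: "nat list list"
    and lam :: "nat list" and f :: cpoly
  assumes "hypersurface_orbital_variety N V"
    and "sigma_set N V {1..<N}"
    and "associated_tableau N V T"
    and "richardson_variety N (tau N V) VR"
    and "associated_tableau N VR TR"
    and "thickness N (tau N V) TR T I"
    and "lam = tableau_shape TR"
    and "I = 1"
    and "nonlinear_generator N V f"
  shows "\<exists>c. c \<noteq> 0 \<and> f = pconst c * minor_coeff N (tau N V) I (hd lam - 1)"
proof -
  define \<tau> where "\<tau> = tau N V"
  define L where "L = lev \<tau> N"
  note f = assms(9)
  have N: "1 \<le> N"
    using sigma_set_full_vars(1)[OF assms(2) f] by simp
  obtain i j where ij: "(1, j) \<in> vars f" "(i, N) \<in> vars f"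
    using sigma_set_full_vars(2,3)[OF assms(2) f] by blast
  have irr: "irreducible_in (zariski N) V"
    using assms(1) by (simp add: hypersurface_orbital_variety_def orbital_variety_irreducible)
  then have V: "V \<subseteq> strict_upper N"
    by (simp add: irreducible_in_def)
  have std: "standard_tableau N T"
    and gen: "generically (zariski N) V (\<lambda>x. has_jordan_type (upper_left N x) (tableau_shape (tableau_upto N T)))"
    using assms(3) N by (auto simp: associated_tableau_def)
  have sub: "\<tau> \<subseteq> {1..<N}"
    by (auto simp: \<tau>_def tau_def)
  have row: "first_row_upto N T = L"
    unfolding L_def using assms(4,5,6,8) std N sub
    by (intro first_row_after_move[of N \<tau> VR TR]) (auto simp: \<tau>_def)
  have hd_lam: "hd lam - 1 = L"
    using hd_tableau_shape[OF assms(4,5) N] assms(7) by (simp add: L_def \<tau>_def)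
  have dvdI: "f dvd p"
    if "p \<in> polys_in (free_coords N \<tau>)" "\<forall>A\<in>V. peval p A = 0" for p
  proof (rule nonlinear_generator_dvd[OF f])
    show "p \<in> polys_in (free_coords N (tau N V))"
      using that(1) by (simp add: \<tau>_def)
    show "peval p A = 0" if "A \<in> Abstract_Topology.closure_of (zariski N) V" for A
      using closure_vanishes[OF polys_in_mono[OF \<open>p \<in> polys_in (free_coords N \<tau>)\<close> free_coords_subset[OF order_refl]] V _ that]
        \<open>\<forall>A\<in>V. peval p A = 0\<close> by blast
  qed
  have dvd: "f dvd walk_poly N \<tau> L a b" if ab: "1 \<le> a" "a \<le> N" "1 \<le> b" "b \<le> N" for a b
  proof (rule dvdI)
    show q: "walk_poly N \<tau> L a b \<in> polys_in (free_coords N \<tau>)"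
      using ab by (rule walk_poly_polys_in)
    have "peval (walk_poly N \<tau> L a b) A = 0"
      if A: "A \<in> V" "has_jordan_type (upper_left N A) (tableau_shape (tableau_upto N T))" for A
    proof -
      have "upper_left N A ^\<^sub>m L = 0\<^sub>m N N"
        using tableau_type_pow_eq_0_iff[OF std N order_refl A(2) upper_left_carrier] row by simp
      moreover have "A \<in> richardson_space N \<tau>"
        using nonlinear_generator_richardson[OF f V] A(1) by (auto simp: \<tau>_def)
      ultimately show ?thesis
        using ab by (subst peval_walk_poly[where N = N]) auto
    qed
    then show "\<forall>A\<in>V. peval (walk_poly N \<tau> L a b) A = 0"
      using generically_vanishes[OF irr gen polys_in_mono[OF q free_coords_subset[OF order_refl]]] by blast
  qed
  have prime: "f dvd p \<or> f dvd q"
    if pq: "p \<in> polys_in (free_coords N \<tau>)" "q \<in> polys_in (free_coords N \<tau>)" "p * q = walk_poly N \<tau> L 1 N" for p q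
  proof -
    have "peval (p * q) A = 0" if "A \<in> V" for A
    proof -
      have "A \<in> Abstract_Topology.closure_of (zariski N) V"
        using closure_of_subset[of V "zariski N"] V that by auto
      then have "peval f A = 0" by (rule nonlinear_generator_vanishes[OF f])
      moreover obtain r where "p * q = f * r"
        using dvd[OF order_refl N N order_refl] pq(3) by (auto elim: dvdE)
      ultimately show ?thesis by (simp add: peval_mult)
    qed
    then have "(\<forall>A\<in>V. peval p A = 0) \<or> (\<forall>A\<in>V. peval q A = 0)"
      using pq(1,2) polys_in_mono[OF _ free_coords_subset[OF order_refl]]
      by (intro irreducible_in_prime[OF irr]) blast+
    then show ?thesis using dvdI pq(1,2) by blast
  qed
  obtain c where c: "c \<noteq> 0" "walk_poly N \<tau> L 1 N = pconst c * f"
    using walk_poly_eq_generator[OF N L_def dvd prime ij] by blast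
  \<comment> \<open>The sign supplied by \<open>minor_coeff_eq\<close>; together with c it makes the
    required scalar the inverse of e * c.\<close>
  define e :: complex where "e = (- 1) ^ (N - 1) * (- 1) ^ L"
  have pconst_mult: "pconst a * pconst b = pconst (a * b)" for a b
    by (simp add: pconst_def mult_single)
  have pconst_power: "(- 1) ^ n = pconst ((- 1) ^ n)" for n
    by (cases "even n") (simp_all add: pconst_def single_uminus)
  have less: "L < N" using lev_less[OF N] by (simp add: L_def)
  have "minor_coeff N \<tau> 1 L = pconst e * (pconst c * f)"
    by (simp only: minor_coeff_eq[OF N less] c(2) pconst_power pconst_mult e_def)
  then have "pconst (inverse (e * c)) * minor_coeff N \<tau> 1 L = pconst (inverse (e * c) * (e * c)) * f"
    by (simp only: mult.assoc[symmetric] pconst_mult)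
  moreover have nz: "e * c \<noteq> 0" using c(1) by (simp add: e_def)
  moreover have "pconst 1 = 1" by (simp add: pconst_def)
  ultimately have "f = pconst (inverse (e * c)) * minor_coeff N \<tau> 1 L"
    by (simp only: left_inverse[OF nz] mult_1_left)
  with nz show ?thesis
    unfolding \<open>I = 1\<close> hd_lam \<tau>_def[symmetric] by (intro exI[of _ "inverse (e * c)"]) simp
qed

end
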